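(* Let $B$ be a densely defined closed symmetric operator on a Hilbert space $\mathcal{H}$ which is completely non-selfadjoint and has finite deficiency indices $(n,n)$, and let $\Pi=(\mathbb{C}^{n},\Gamma_{1},\Gamma_{2})$ be a boundary triplet for $B^{*}$. Let $A_1$ be the self-adjoint extension of $B$ with domain $D(A_1)=\operatorname{Ker}\Gamma_1$, and for $D\in\mathbb{H}_n$ let $A_D$ be the self-adjoint extension of $B$ with domain $D(A_D)=\operatorname{Ker}(\Gamma_2-D\Gamma_1)$. Then the set $$\{x\in\sigma(A_{1}) : x\notin\sigma_{p}^{max}(A_{D}) \text{ for every } D\in\mathbb{H}_{n}\}$$ is a dense $G_{\delta}$ subset of $\sigma(A_{1})$ (with the relative topology).
   Context: Deficiency indices: $d_\pm(B)=\dim\operatorname{Ker}(B^*\mp iI)$. A boundary triplet for $B^*$ (when $d_+(B)=d_-(B)=n$) is a triple $(\mathbb{C}^n,\Gamma_1,\Gamma_2)$ of linear maps $\Gamma_i:D(B^* )\to\mathbb{C}^n$ such that $\langle B^*x,y\rangle-\langle x,B^*y\rangle=\langle\Gamma_2x,\Gamma_1y\rangle-\langle\Gamma_1x,\Gamma_2y\rangle$ for all $x,y\in D(B^* )$, and the map $x\mapsto(\Gamma_1x,\Gamma_2x)$ from $D(B^* )$ to $\mathbb{C}^n\oplus\mathbb{C}^n$ is surjective. All extensions are restrictions of $B^*$ to the indicated domains. $\mathbb{H}_n$ denotes the set of symmetric (i.e. self-adjoint/Hermitian) $n\times n$ complex matrices. A closed operator is completely non-selfadjoint if there is no subspace reducing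 it on which its part is self-adjoint. For a self-adjoint extension $A$ of $B$, an eigenvalue $z$ of $A$ is of maximum multiplicity if $\dim\operatorname{Ker}(A-zI)=n$; $\sigma_p^{max}(A)$ denotes the set of such eigenvalues. *)

theory Defs
  imports "HOL-Analysis.Analysis"
begin

class complex_hilbert = ab_group_add +
  fixes scaleC :: "complex \<Rightarrow> 'a \<Rightarrow> 'a" (infixr "*\<^sub>C" 75)
  fixes cinner :: "'a \<Rightarrow> 'a \<Rightarrow> complex"
  assumes scaleC_add_right: "a *\<^sub>C (x + y) = a *\<^sub>C x + a *\<^sub>C y"
  assumes scaleC_add_left: "(a + b) *\<^sub>C x = a *\<^sub>C x + b *\<^sub>C x"
  assumes scaleC_scaleC: "a *\<^sub>C (b *\<^sub>C x) = (a * b) *\<^sub>C x"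
  assumes scaleC_one: "1 *\<^sub>C x = x"
  assumes cinner_cnj: "cinner x y = cnj (cinner y x)"
  assumes cinner_add_left: "cinner (x + y) z = cinner x z + cinner y z"
  assumes cinner_scaleC_left: "cinner (a *\<^sub>C x) y = a * cinner x y"
  assumes cinner_ge_zero: "Im (cinner x x) = 0 \<and> Re (cinner x x) \<ge> 0"
  assumes cinner_eq_zero_iff: "cinner x x = 0 \<longleftrightarrow> x = 0"
  assumes cinner_complete:
    "(\<forall>e>0. \<exists>N. \<forall>m\<ge>N. \<forall>k\<ge>N. sqrt (Re (cinner (X m - X k) (X m - X k))) < e)
      \<Longrightarrow> \<exists>L. (\<lambda>k. sqrt (Re (cinner (X k - L) (X k - L)))) \<longlonglongrightarrow> 0"

definition cnorm :: "'a::complex_hilbert \<Rightarrow> real" where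
  "cnorm x = sqrt (Re (cinner x x))"

definition converges_to :: "(nat \<Rightarrow> 'a::complex_hilbert) \<Rightarrow> 'a \<Rightarrow> bool" where
  "converges_to X L \<longleftrightarrow> (\<lambda>k. cnorm (X k - L)) \<longlonglongrightarrow> 0"

definition csubspace :: "'a::complex_hilbert set \<Rightarrow> bool" where
  "csubspace S \<longleftrightarrow> 0 \<in> S \<and> (\<forall>x\<in>S. \<forall>y\<in>S. x + y \<in> S) \<and> (\<forall>c. \<forall>x\<in>S. c *\<^sub>C x \<in> S)"

definition cclosed :: "'a::complex_hilbert set \<Rightarrow> bool" where
  "cclosed S \<longleftrightarrow> (\<forall>X L. (\<forall>k. X k \<in> S) \<and> converges_to X L \<longrightarrow> L \<in> S)"

definition dense_in :: "'a::complex_hilbert set \<Rightarrow> 'a set \<Rightarrow> bool" where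
  "dense_in S T \<longleftrightarrow> S \<subseteq> T \<and> (\<forall>x\<in>T. \<forall>e>0. \<exists>y\<in>S. cnorm (x - y) < e)"

definition cdim_eq :: "'a::complex_hilbert set \<Rightarrow> nat \<Rightarrow> bool" where
  "cdim_eq S n \<longleftrightarrow> (\<exists>e :: nat \<Rightarrow> 'a.
     (\<forall>i<n. e i \<in> S) \<and>
     (\<forall>c. (\<Sum>i<n. c i *\<^sub>C e i) = 0 \<longrightarrow> (\<forall>i<n. c i = 0)) \<and>
     (\<forall>x\<in>S. \<exists>c. x = (\<Sum>i<n. c i *\<^sub>C e i)))"

text \<open>An operator is a pair (domain, action); the action is irrelevant outside the domain.\<close>
type_synonym 'a op = "'a set \<times> ('a \<Rightarrow> 'a)"

definition dom :: "'a op \<Rightarrow> 'a set" where "dom T = fst T"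
definition app :: "'a op \<Rightarrow> 'a \<Rightarrow> 'a" where "app T = snd T"

definition linear_op :: "'a::complex_hilbert op \<Rightarrow> bool" where
  "linear_op T \<longleftrightarrow> csubspace (dom T) \<and>
     (\<forall>x\<in>dom T. \<forall>y\<in>dom T. \<forall>a b. app T (a *\<^sub>C x + b *\<^sub>C y) = a *\<^sub>C app T x + b *\<^sub>C app T y)"

definition densely_defined :: "'a::complex_hilbert op \<Rightarrow> bool" where
  "densely_defined T \<longleftrightarrow> dense_in (dom T) UNIV"

definition closed_op :: "'a::complex_hilbert op \<Rightarrow> bool" where
  "closed_op T \<longleftrightarrow> linear_op T \<and>
     (\<forall>X x y. (\<forall>k. X k \<in> dom T) \<and> converges_to X x \<and> converges_to (\<lambda>k. app T (X k)) y
        \<longrightarrow> x \<in> dom T \<and> app T x = y)"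

definition adjoint :: "'a::complex_hilbert op \<Rightarrow> 'a op" where
  "adjoint T = ({y. \<exists>z. \<forall>x\<in>dom T. cinner (app T x) y = cinner x z},
                (\<lambda>y. THE z. \<forall>x\<in>dom T. cinner (app T x) y = cinner x z))"

definition op_eq :: "'a op \<Rightarrow> 'a op \<Rightarrow> bool" where
  "op_eq S T \<longleftrightarrow> dom S = dom T \<and> (\<forall>x\<in>dom S. app S x = app T x)"

definition symmetric_op :: "'a::complex_hilbert op \<Rightarrow> bool" where
  "symmetric_op T \<longleftrightarrow> linear_op T \<and> densely_defined T \<and>
     (\<forall>x\<in>dom T. \<forall>y\<in>dom T. cinner (app T x) y = cinner x (app T y))"

definition selfadjoint_op :: "'a::complex_hilbert op \<Rightarrow> bool" where
  "selfadjoint_op T \<longleftrightarrow> linear_op T \<and> densely_defined T \<and> op_eq T (adjoint T)"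

definition restrict_op :: "'a op \<Rightarrow> 'a set \<Rightarrow> 'a op" where
  "restrict_op T S = (dom T \<inter> S, app T)"

definition ker_shift :: "'a::complex_hilbert op \<Rightarrow> complex \<Rightarrow> 'a set" where
  "ker_shift T z = {x \<in> dom T. app T x = z *\<^sub>C x}"

definition resolvent_set :: "'a::complex_hilbert op \<Rightarrow> complex set" where
  "resolvent_set T = {z. (\<forall>y. \<exists>!x. x \<in> dom T \<and> app T x - z *\<^sub>C x = y) \<and>
      (\<exists>C. \<forall>x\<in>dom T. cnorm x \<le> C * cnorm (app T x - z *\<^sub>C x))}"

definition spectrum_op :: "'a::complex_hilbert op \<Rightarrow> complex set" where
  "spectrum_op T = - resolvent_set T"

definition sigma_p_max :: "nat \<Rightarrow> 'a::complex_hilbert op \<Rightarrow> complex set" where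
  "sigma_p_max n A = {z. cdim_eq (ker_shift A z) n}"

definition proj :: "'a::complex_hilbert set \<Rightarrow> 'a \<Rightarrow> 'a" where
  "proj L x = (THE y. y \<in> L \<and> (\<forall>z\<in>L. cinner (x - y) z = 0))"

definition reduces :: "'a::complex_hilbert set \<Rightarrow> 'a op \<Rightarrow> bool" where
  "reduces L T \<longleftrightarrow> csubspace L \<and> cclosed L \<and>
     (\<forall>x\<in>dom T. proj L x \<in> dom T \<and> app T (proj L x) = proj L (app T x))"

text \<open>The part of \<open>T\<close> in \<open>L\<close> (domain \<open>D(T) \<inter> L\<close>) is self-adjoint as an operator
in the Hilbert space \<open>L\<close>.\<close>
definition part_selfadjoint :: "'a::complex_hilbert set \<Rightarrow> 'a op \<Rightarrow> bool" where
  "part_selfadjoint L T \<longleftrightarrow>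
     dense_in (dom T \<inter> L) L \<and> (\<forall>x\<in>dom T \<inter> L. app T x \<in> L) \<and>
     (\<forall>y\<in>L. (\<exists>z\<in>L. \<forall>x\<in>dom T \<inter> L. cinner (app T x) y = cinner x z) \<longleftrightarrow> y \<in> dom T) \<and>
     (\<forall>x\<in>dom T \<inter> L. \<forall>y\<in>dom T \<inter> L. cinner (app T x) y = cinner x (app T y))"

definition completely_non_selfadjoint :: "'a::complex_hilbert op \<Rightarrow> bool" where
  "completely_non_selfadjoint T \<longleftrightarrow>
     closed_op T \<and> \<not> (\<exists>L. L \<noteq> {0} \<and> reduces L T \<and> part_selfadjoint L T)"

definition deficiency_indices_eq :: "'a::complex_hilbert op \<Rightarrow> nat \<Rightarrow> bool" where
  "deficiency_indices_eq B n \<longleftrightarrow>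
     cdim_eq (ker_shift (adjoint B) \<i>) n \<and> cdim_eq (ker_shift (adjoint B) (- \<i>)) n"

definition vinner :: "complex ^ 'n::finite \<Rightarrow> complex ^ 'n \<Rightarrow> complex" where
  "vinner u v = (\<Sum>i\<in>UNIV. u $ i * cnj (v $ i))"

definition boundary_triplet ::
  "'a::complex_hilbert op \<Rightarrow> ('a \<Rightarrow> complex ^ 'n::finite) \<Rightarrow> ('a \<Rightarrow> complex ^ 'n) \<Rightarrow> bool" where
  "boundary_triplet B G1 G2 \<longleftrightarrow>
     (let Bs = adjoint B in
      (\<forall>x\<in>dom Bs. \<forall>y\<in>dom Bs. \<forall>a b.
         G1 (a *\<^sub>C x + b *\<^sub>C y) = a *s G1 x + b *s G1 y \<and>
         G2 (a *\<^sub>C x + b *\<^sub>C y) = a *s G2 x + b *s G2 y) \<and>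
      (\<forall>x\<in>dom Bs. \<forall>y\<in>dom Bs.
         cinner (app Bs x) y - cinner x (app Bs y) = vinner (G2 x) (G1 y) - vinner (G1 x) (G2 y)) \<and>
      (\<forall>u v. \<exists>x\<in>dom Bs. G1 x = u \<and> G2 x = v))"

definition hermitian :: "complex ^ 'n ^ 'n \<Rightarrow> bool" where
  "hermitian D \<longleftrightarrow> (\<forall>i j. D $ i $ j = cnj (D $ j $ i))"

end

theory Submission
  imports Defs "HOL-Complex_Analysis.Conformal_Mappings"
begin

text \<open>Write \<open>A\<close> for \<open>A\<^sub>1\<close> and let \<open>F\<^sub>k\<close> be the closed set of all \<open>x\<close> with
  \<open>\<bar>\<Gamma>\<^sub>2 y\<bar> \<le> k \<parallel>(A - x) y\<parallel>\<close> for all \<open>y\<close> in the domain of \<open>A\<close>. By Green's formula and the Riesz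
  theorem, \<open>x \<in> \<sigma>(A)\<close> lies in some \<open>F\<^sub>k\<close> iff \<open>\<Gamma>\<^sub>1\<close> maps the kernel of \<open>B* - x\<close> bijectively
  onto \<open>\<complex>\<^sup>n\<close>, i.e. iff \<open>x\<close> is an eigenvalue of maximal multiplicity of the \<open>A\<^sub>D\<close> with
  \<open>D = \<Gamma>\<^sub>2 \<Gamma>\<^sub>1\<^sup>-\<^sup>1\<close>. So the set in question is \<open>\<sigma>(A)\<close> minus the union of the \<open>F\<^sub>k\<close>, and by Baire
  it remains to see that \<open>F\<^sub>k\<close> has no interior in \<open>\<sigma>(A)\<close>.

  If \<open>F\<^sub>k\<close> contained \<open>\<sigma>(A)\<close> near \<open>x\<^sub>0 \<in> \<sigma>(A)\<close>, a bound with \<open>2k\<close> would hold at all points of a complex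
  disc around \<open>x\<^sub>0\<close>, and the vectors \<open>g z\<close> representing \<open>\<Gamma>\<^sub>2\<close> through \<open>A - cnj z\<close> would be bounded and
  holomorphic off the real line, weakly continuous across it, hence holomorphic. Then
  \<open>g x\<^sub>0\<close> lies in the spectral subspace \<open>K\<close> of \<open>A\<close> away from \<open>x\<^sub>0\<close>, here obtained without spectral
  measures as the vectors \<open>f\<close> with \<open>\<parallel>(A - x\<^sub>0)\<^sup>-\<^sup>n f\<parallel> = O(R\<^sup>n)\<close>. Consequently \<open>\<Gamma>\<^sub>2\<close> vanishes on the
  orthogonal complement of \<open>K\<close>, which therefore reduces \<open>B\<close> to a self-adjoint part and must be \<open>0\<close>;
  but \<open>A - x\<^sub>0\<close> is invertible on \<open>K\<close>.\<close>

section \<open>Hilbert spaces\<close>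

lemma scaleC_zero_left [simp]: "0 *\<^sub>C (x::'a::complex_hilbert) = 0"
  using scaleC_add_left[of 0 0 x] by simp

lemma scaleC_zero_right [simp]: "c *\<^sub>C (0::'a::complex_hilbert) = 0"
  using scaleC_add_right[of c 0 "0::'a"] by simp

lemma scaleC_minus_left: "(- c) *\<^sub>C (x::'a::complex_hilbert) = - (c *\<^sub>C x)"
  using scaleC_add_left[of c "- c" x] by (simp add: eq_neg_iff_add_eq_0 add.commute)

lemma scaleC_minus_one: "(- 1) *\<^sub>C (x::'a::complex_hilbert) = - x"
  by (simp add: scaleC_minus_left scaleC_one)

lemma scaleC_minus_right: "c *\<^sub>C (- x) = - (c *\<^sub>C (x::'a::complex_hilbert))"
  using scaleC_add_right[of c x "- x"] by (simp add: eq_neg_iff_add_eq_0 add.commute)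

lemma scaleC_diff_right: "c *\<^sub>C (x - y) = c *\<^sub>C x - c *\<^sub>C (y::'a::complex_hilbert)"
  by (metis diff_conv_add_uminus scaleC_add_right scaleC_minus_right)

lemma scaleC_diff_left: "(a - b) *\<^sub>C x = a *\<^sub>C x - b *\<^sub>C (x::'a::complex_hilbert)"
  by (metis diff_conv_add_uminus scaleC_add_left scaleC_minus_left)

lemma cinner_zero_left [simp]: "cinner 0 (x::'a::complex_hilbert) = 0"
  using cinner_add_left[of 0 0 x] by simp

lemma cinner_zero_right [simp]: "cinner (x::'a::complex_hilbert) 0 = 0"
  using cinner_cnj[of x 0] by simp

lemma cinner_add_right: "cinner x (y + z) = cinner x y + cinner x (z::'a::complex_hilbert)"
  by (metis cinner_add_left cinner_cnj complex_cnj_add)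

lemma cinner_scaleC_right: "cinner x (a *\<^sub>C y) = cnj a * cinner x (y::'a::complex_hilbert)"
  by (metis cinner_scaleC_left cinner_cnj complex_cnj_mult)

lemma cinner_minus_left: "cinner (- x) y = - cinner x (y::'a::complex_hilbert)"
  by (metis cinner_scaleC_left scaleC_minus_one mult_minus1)

lemma cinner_minus_right: "cinner x (- y) = - cinner x (y::'a::complex_hilbert)"
  by (metis cinner_minus_left cinner_cnj complex_cnj_minus)

lemma cinner_diff_left: "cinner (x - y) z = cinner x z - cinner y (z::'a::complex_hilbert)"
  by (metis cinner_add_left cinner_minus_left diff_conv_add_uminus)

lemma cinner_diff_right: "cinner x (y - z) = cinner x y - cinner x (z::'a::complex_hilbert)"
  by (metis cinner_add_right cinner_minus_right diff_conv_add_uminus)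

lemmas cinner_simps = cinner_add_left cinner_add_right cinner_diff_left cinner_diff_right
  cinner_minus_left cinner_minus_right cinner_scaleC_left cinner_scaleC_right

section \<open>Norm, Cauchy-Schwarz and triangle inequalities\<close>

lemma cinner_self: "cinner x x = complex_of_real ((cnorm (x::'a::complex_hilbert))\<^sup>2)"
  using cinner_ge_zero[of x] by (simp add: cnorm_def complex_eq_iff)

lemma cnorm_ge_zero [simp]: "cnorm (x::'a::complex_hilbert) \<ge> 0"
  using cinner_ge_zero[of x] by (simp add: cnorm_def)

lemma cnorm_eq_zero [simp]: "cnorm (x::'a::complex_hilbert) = 0 \<longleftrightarrow> x = 0"
  using cinner_self[of x] cinner_eq_zero_iff[of x] by simp

lemma cnorm_zero [simp]: "cnorm (0::'a::complex_hilbert) = 0"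
  by simp

lemma cnorm_scaleC: "cnorm (c *\<^sub>C x) = cmod c * cnorm (x::'a::complex_hilbert)"
proof -
  have "cinner (c *\<^sub>C x) (c *\<^sub>C x) = (c * cnj c) * cinner x x" by (simp add: cinner_simps)
  also have "\<dots> = complex_of_real ((cmod c)\<^sup>2) * complex_of_real ((cnorm x)\<^sup>2)"
    by (simp only: complex_norm_square cinner_self)
  also have "\<dots> = complex_of_real ((cmod c * cnorm x)\<^sup>2)" by (simp add: power_mult_distrib)
  finally have "cinner (c *\<^sub>C x) (c *\<^sub>C x) = complex_of_real ((cmod c * cnorm x)\<^sup>2)" .
  then have "(cnorm (c *\<^sub>C x))\<^sup>2 = (cmod c * cnorm x)\<^sup>2"
    using cinner_self[of "c *\<^sub>C x"] by (metis of_real_eq_iff)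
  then show ?thesis by (simp add: power2_eq_iff_nonneg)
qed

lemma cnorm_minus: "cnorm (- x) = cnorm (x::'a::complex_hilbert)"
  using cnorm_scaleC[of "- 1" x] by (simp add: scaleC_minus_one)

lemma cnorm_minus_commute: "cnorm (x - y) = cnorm (y - (x::'a::complex_hilbert))"
  using cnorm_minus[of "x - y"] by simp

lemma cnorm_add_sq:
  "(cnorm (x + y))\<^sup>2 = (cnorm x)\<^sup>2 + 2 * Re (cinner x y) + (cnorm (y::'a::complex_hilbert))\<^sup>2"
proof -
  have "Re (cinner y x) = Re (cinner x y)" using cinner_cnj[of y x] by simp
  then have "Re (cinner (x + y) (x + y)) = Re (cinner x x) + 2 * Re (cinner x y) + Re (cinner y y)"
    by (simp add: cinner_simps)
  then show ?thesis by (simp add: cinner_self)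
qed

lemma cnorm_diff_sq:
  "(cnorm (x - y))\<^sup>2 = (cnorm x)\<^sup>2 - 2 * Re (cinner x y) + (cnorm (y::'a::complex_hilbert))\<^sup>2"
  using cnorm_add_sq[of x "- y"] by (simp add: cinner_simps cnorm_minus)

lemma cauchy_schwarz: "cmod (cinner x y) \<le> cnorm x * cnorm (y::'a::complex_hilbert)"
proof (cases "y = 0")
  case False
  define b where "b = cnorm y"
  have b: "b > 0" using False by (simp add: b_def less_le)
  define c where "c = cinner x y / complex_of_real (b\<^sup>2)"
  have "cinner x (c *\<^sub>C y) = (cinner x y * cnj (cinner x y)) / complex_of_real (b\<^sup>2)"
    by (simp add: c_def cinner_scaleC_right)
  also have "\<dots> = complex_of_real ((cmod (cinner x y))\<^sup>2 / b\<^sup>2)"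
    by (simp only: complex_norm_square of_real_divide)
  finally have "Re (cinner x (c *\<^sub>C y)) = (cmod (cinner x y))\<^sup>2 / b\<^sup>2" by (simp only: Re_complex_of_real)
  moreover have "cnorm (c *\<^sub>C y) = cmod (cinner x y) / b"
    using b by (simp add: cnorm_scaleC c_def norm_divide b_def[symmetric] power2_eq_square norm_mult)
  ultimately have "(cnorm x)\<^sup>2 - (cmod (cinner x y) / b)\<^sup>2 = (cnorm (x - c *\<^sub>C y))\<^sup>2"
    by (simp add: cnorm_diff_sq power_divide)
  then have "(cmod (cinner x y) / b)\<^sup>2 \<le> (cnorm x)\<^sup>2"
    by (metis diff_ge_0_iff_ge zero_le_power2)
  then have "cmod (cinner x y) / b \<le> cnorm x" by (rule power2_le_imp_le) simp
  then show ?thesis using b by (simp add: b_def field_simps)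
qed simp

lemma cnorm_triangle: "cnorm (x + y) \<le> cnorm x + cnorm (y::'a::complex_hilbert)"
proof (rule power2_le_imp_le)
  have "Re (cinner x y) \<le> cnorm x * cnorm y"
    using cauchy_schwarz[of x y] complex_Re_le_cmod order_trans by blast
  then show "(cnorm (x + y))\<^sup>2 \<le> (cnorm x + cnorm y)\<^sup>2"
    by (simp add: cnorm_add_sq power2_sum)
qed simp

lemma cnorm_triangle_diff: "cnorm (x - z) \<le> cnorm (x - y) + cnorm (y - (z::'a::complex_hilbert))"
  using cnorm_triangle[of "x - y" "y - z"] by simp

lemma cnorm_diff_triangle: "cnorm (x - y) \<le> cnorm x + cnorm (y::'a::complex_hilbert)"
  using cnorm_triangle[of x "- y"] by (simp add: cnorm_minus)

lemma cnorm_le_add_diff: "cnorm x \<le> cnorm y + cnorm (x - (y::'a::complex_hilbert))"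
  using cnorm_triangle[of y "x - y"] by simp

section \<open>Convergence and completeness\<close>

lemma tendsto_cinner_left:
  fixes X :: "nat \<Rightarrow> 'a::complex_hilbert"
  assumes "converges_to X L" shows "(\<lambda>k. cinner (X k) y) \<longlonglongrightarrow> cinner L y"
proof -
  have "(\<lambda>k. cnorm (X k - L) * cnorm y) \<longlonglongrightarrow> 0"
    using assms tendsto_mult_left_zero unfolding converges_to_def by blast
  then have "(\<lambda>k. cinner (X k) y - cinner L y) \<longlonglongrightarrow> 0"
    by (rule Lim_null_comparison[rotated]) (simp add: cauchy_schwarz flip: cinner_diff_left)
  then show ?thesis by (simp add: LIM_zero_iff)
qed

lemma tendsto_cinner_right:
  fixes X :: "nat \<Rightarrow> 'a::complex_hilbert"
  assumes "converges_to X L" shows "(\<lambda>k. cinner y (X k)) \<longlonglongrightarrow> cinner y L"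
  using tendsto_cnj[OF tendsto_cinner_left[OF assms, of y]] by (simp flip: cinner_cnj)

lemma tendsto_cnorm:
  fixes X :: "nat \<Rightarrow> 'a::complex_hilbert"
  assumes "converges_to X L" shows "(\<lambda>k. cnorm (X k)) \<longlonglongrightarrow> cnorm L"
proof -
  have "norm (cnorm (X k) - cnorm L) \<le> cnorm (X k - L)" for k
    using cnorm_le_add_diff[of "X k" L] cnorm_le_add_diff[of L "X k"] cnorm_minus_commute[of L "X k"]
    unfolding real_norm_def by linarith
  then have "(\<lambda>k. cnorm (X k) - cnorm L) \<longlonglongrightarrow> 0"
    by (intro Lim_null_comparison[OF always_eventually assms[unfolded converges_to_def]] allI)
  then show ?thesis by (simp add: LIM_zero_iff)
qed

lemma cauchy_converges:
  fixes X :: "nat \<Rightarrow> 'a::complex_hilbert"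
  assumes "\<And>e. e > 0 \<Longrightarrow> \<exists>N. \<forall>m\<ge>N. \<forall>k\<ge>N. cnorm (X m - X k) < e"
  shows "\<exists>L. converges_to X L"
  unfolding converges_to_def cnorm_def
  by (rule cinner_complete) (use assms in \<open>simp add: cnorm_def\<close>)

section \<open>Subspaces and Riesz representation\<close>

lemma csubspace_diff: "csubspace S \<Longrightarrow> x \<in> S \<Longrightarrow> y \<in> S \<Longrightarrow> x - y \<in> S"
  unfolding csubspace_def by (metis diff_conv_add_uminus scaleC_minus_one)

lemma csubspace_sum:
  "csubspace S \<Longrightarrow> (\<And>i. i \<in> I \<Longrightarrow> f i \<in> S) \<Longrightarrow> (\<Sum>i\<in>I. f i) \<in> S"
  by (induction I rule: infinite_finite_induct) (auto simp: csubspace_def)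

text \<open>The representing vector is the limit of \<open>T y\<close> along a sequence minimising
  \<open>\<parallel>T y\<parallel>\<^sup>2 - 2 Re (l y)\<close>; the parallelogram law makes that sequence Cauchy.\<close>

lemma riesz_range:
  fixes T :: "'b::complex_hilbert \<Rightarrow> 'a::complex_hilbert"
  assumes D: "csubspace D"
    and Tadd: "\<And>x y. x \<in> D \<Longrightarrow> y \<in> D \<Longrightarrow> T (x + y) = T x + T y"
    and Tscale: "\<And>c x. x \<in> D \<Longrightarrow> T (c *\<^sub>C x) = c *\<^sub>C T x"
    and ladd: "\<And>x y. x \<in> D \<Longrightarrow> y \<in> D \<Longrightarrow> l (x + y) = l x + l y"
    and lscale: "\<And>c x. x \<in> D \<Longrightarrow> l (c *\<^sub>C x) = c * l x"
    and bound: "\<And>y. y \<in> D \<Longrightarrow> cmod (l y) \<le> C * cnorm (T y)" and "C \<ge> 0"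
  obtains g Y where "\<And>y. y \<in> D \<Longrightarrow> cinner (T y) g = l y" and "cnorm g \<le> C"
    and "\<And>k. Y k \<in> D" and "converges_to (\<lambda>k. T (Y k)) g"
proof -
  have mem: "x + y \<in> D" "c *\<^sub>C x \<in> D" if "x \<in> D" "y \<in> D" for x y c
    using D that by (auto simp: csubspace_def)
  have D0: "0 \<in> D" using D by (simp add: csubspace_def)
  define J where "J y = (cnorm (T y))\<^sup>2 - 2 * Re (l y)" for y
  have J_lower: "J y \<ge> - C\<^sup>2" if "y \<in> D" for y
  proof -
    have "Re (l y) \<le> C * cnorm (T y)" using bound[OF that] complex_Re_le_cmod order_trans by blast
    then have "J y + C\<^sup>2 \<ge> (cnorm (T y) - C)\<^sup>2" by (simp add: J_def power2_diff mult.commute)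
    then show ?thesis by (smt (verit) zero_le_power2)
  qed
  define m where "m = Inf (J ` D)"
  have bdd: "bdd_below (J ` D)" using J_lower by (intro bdd_belowI[of _ "- C\<^sup>2"]) auto
  have m_le: "m \<le> J y" if "y \<in> D" for y
    unfolding m_def using bdd that by (intro cInf_lower) auto
  have "\<exists>y\<in>D. J y < m + 1 / (real k + 1)" for k
  proof (rule ccontr)
    assume "\<not> (\<exists>y\<in>D. J y < m + 1 / (real k + 1))"
    then have "m + 1 / (real k + 1) \<le> m"
      unfolding m_def using D0 by (intro cInf_greatest) (auto simp: not_less)
    moreover have "1 / (real k + 1) > 0" by simp
    ultimately show False by linarith
  qed
  then obtain Y where Y: "\<And>k. Y k \<in> D" and JY: "\<And>k. J (Y k) < m + 1 / (real k + 1)" by metis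
  have close: "(cnorm (T (Y i) - T (Y j)))\<^sup>2 \<le> 2 / (real i + 1) + 2 / (real j + 1)" for i j
  proof -
    define z where "z = (1/2) *\<^sub>C (Y i + Y j)"
    have z: "z \<in> D" using Y by (auto simp: z_def intro!: mem)
    have Tz: "T z = (1/2) *\<^sub>C (T (Y i) + T (Y j))" and lz: "l z = (1/2) * (l (Y i) + l (Y j))"
      using Y by (auto simp: z_def Tadd Tscale ladd lscale mem)
    have nz: "4 * (cnorm (T z))\<^sup>2 = (cnorm (T (Y i) + T (Y j)))\<^sup>2"
      by (simp add: Tz cnorm_scaleC power_mult_distrib norm_divide power_divide)
    have "(cnorm (T (Y i) - T (Y j)))\<^sup>2 = 2 * J (Y i) + 2 * J (Y j) - 4 * J z"
      using nz by (simp add: J_def lz cnorm_diff_sq cnorm_add_sq algebra_simps)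
    then show ?thesis using JY[of i] JY[of j] m_le[OF z] by (simp add: algebra_simps)
  qed
  have "\<exists>g. converges_to (\<lambda>k. T (Y k)) g"
  proof (rule cauchy_converges)
    fix e :: real assume e: "e > 0"
    obtain N :: nat where N: "real N > 4 / e\<^sup>2" using reals_Archimedean2 by blast
    have "cnorm (T (Y i) - T (Y j)) < e" if "i \<ge> N" "j \<ge> N" for i j
    proof -
      have small: "2 / (real n + 1) < e\<^sup>2 / 2" if "n \<ge> N" for n
      proof -
        have "4 / e\<^sup>2 < real n + 1" using N that by linarith
        then show ?thesis using e by (simp add: divide_simps mult.commute)
      qed
      have "(cnorm (T (Y i) - T (Y j)))\<^sup>2 < e\<^sup>2" using close[of i j] small[OF that(1)] small[OF that(2)] by linarith
      then show ?thesis using e power_less_imp_less_base by fastforce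
    qed
    then show "\<exists>N. \<forall>m\<ge>N. \<forall>k\<ge>N. cnorm (T (Y m) - T (Y k)) < e" by blast
  qed
  then obtain g where g: "converges_to (\<lambda>k. T (Y k)) g" ..
  \<comment> \<open>Moving the minimising sequence by \<open>t\<close> times \<open>y\<close>,
    \<open>t\<close> real, cannot bring \<open>J\<close> below \<open>m\<close>. In the limit a real
    quadratic in \<open>t\<close> without constant term is nonnegative everywhere, so its linear
    coefficient vanishes.\<close>
  have re: "Re (cinner (T y) g - l y) = 0" if y: "y \<in> D" for y
  proof -
    define a b where "a = Re (cinner (T y) g - l y)" and "b = (cnorm (T y))\<^sup>2"
    have pos: "0 \<le> 2 * t * a + t\<^sup>2 * b" for t
    proof (rule tendsto_lowerbound)
      have "(\<lambda>k. 2 * t * (Re (cinner (T y) (T (Y k))) - Re (l y)) + t\<^sup>2 * b + 1 / (real k + 1))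
        \<longlonglongrightarrow> 2 * t * (Re (cinner (T y) g) - Re (l y)) + t\<^sup>2 * b + 0"
        using LIMSEQ_inverse_real_of_nat
        by (intro tendsto_intros tendsto_cinner_right g) (simp add: inverse_eq_divide add.commute)
      then show "(\<lambda>k. 2 * t * (Re (cinner (T y) (T (Y k))) - Re (l y)) + t\<^sup>2 * b + 1 / (real k + 1))
        \<longlonglongrightarrow> 2 * t * a + t\<^sup>2 * b" by (simp add: a_def)
      have "0 \<le> 2 * t * (Re (cinner (T y) (T (Y k))) - Re (l y)) + t\<^sup>2 * b + 1 / (real k + 1)" for k
      proof -
        have sym: "Re (cinner (T (Y k)) (T y)) = Re (cinner (T y) (T (Y k)))"
          using cinner_cnj[of "T (Y k)" "T y"] by simp
        have "J (Y k + complex_of_real t *\<^sub>C y)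
          = J (Y k) + 2 * t * (Re (cinner (T y) (T (Y k))) - Re (l y)) + t\<^sup>2 * b"
        proof -
          have "complex_of_real t *\<^sub>C y \<in> D" by (rule mem(2)[OF y y])
          then have "T (Y k + complex_of_real t *\<^sub>C y) = T (Y k) + complex_of_real t *\<^sub>C T y"
            and "l (Y k + complex_of_real t *\<^sub>C y) = l (Y k) + complex_of_real t * l y"
            by (simp_all only: Tadd[OF Y] ladd[OF Y] Tscale[OF y] lscale[OF y])
          moreover have "(cnorm (complex_of_real t *\<^sub>C T y))\<^sup>2 = t\<^sup>2 * b"
            by (simp add: cnorm_scaleC power_mult_distrib b_def)
          ultimately show ?thesis
            by (simp add: J_def cnorm_add_sq cinner_scaleC_right sym right_diff_distrib)
        qed
        moreover have "m \<le> J (Y k + complex_of_real t *\<^sub>C y)" using Y[of k] y by (auto intro!: m_le mem)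
        ultimately show ?thesis using JY[of k] by linarith
      qed
      then show "\<forall>\<^sub>F k in sequentially. 0 \<le> 2 * t * (Re (cinner (T y) (T (Y k))) - Re (l y)) + t\<^sup>2 * b
          + 1 / (real k + 1)" by simp
    qed simp
    have b: "b \<ge> 0" by (simp add: b_def)
    have "a = 0"
    proof (rule ccontr)
      assume "a \<noteq> 0"
      \<comment> \<open>The value \<open>t = - q\<close> makes the quadratic equal to
        \<open>- q\<^sup>2 * (b + 2)\<close>; dividing by \<open>b + 1\<close> instead of
        \<open>b\<close> also covers \<open>b = 0\<close>.\<close>
      define q where "q = a / (b + 1)"
      have aq: "a = q * (b + 1)" using b by (simp add: q_def)
      have "0 \<le> 2 * (- q) * (q * (b + 1)) + (- q)\<^sup>2 * b" using pos[of "- q"] unfolding aq .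
      then have "q\<^sup>2 * (b + 2) \<le> 0" by (simp add: algebra_simps power2_eq_square)
      moreover have "q\<^sup>2 * (b + 2) > 0" using b \<open>a \<noteq> 0\<close> aq by (intro mult_pos_pos) auto
      ultimately show False by linarith
    qed
    then show ?thesis by (simp add: a_def)
  qed
  have eq: "cinner (T y) g = l y" if y: "y \<in> D" for y
  proof -
    \<comment> \<open>The real identity for \<open>\<i> *\<^sub>C y\<close> is the imaginary part of
      the identity for \<open>y\<close>.\<close>
    have "\<i> *\<^sub>C y \<in> D" using y mem by blast
    from re[OF this] have "Im (cinner (T y) g - l y) = 0"
      by (simp add: Tscale[OF y] lscale[OF y] cinner_scaleC_left)
    with re[OF y] show ?thesis by (simp add: complex_eq_iff)
  qed
  have "(\<lambda>k. C * cnorm (T (Y k))) \<longlonglongrightarrow> C * cnorm g"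
    by (intro tendsto_intros tendsto_cnorm g)
  moreover have "(\<lambda>k. cmod (cinner (T (Y k)) g)) \<longlonglongrightarrow> cmod (cinner g g)"
    by (intro tendsto_intros tendsto_cinner_left g)
  ultimately have "cmod (cinner g g) \<le> C * cnorm g"
    by (rule tendsto_le[OF sequentially_bot]) (simp add: eq Y bound)
  then have "cnorm g * cnorm g \<le> C * cnorm g" by (simp add: cinner_self power2_eq_square norm_mult)
  then have "cnorm g \<le> C"
    using \<open>C \<ge> 0\<close> mult_le_cancel_right[of "cnorm g" "cnorm g" C] cnorm_ge_zero[of g] by linarith
  show ?thesis
  proof (rule that[of g Y])
    show "cinner (T y) g = l y" if "y \<in> D" for y by (rule eq[OF that])
  qed (rule \<open>cnorm g \<le> C\<close> Y g)+
qed

section \<open>Orthogonal projections\<close>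

text \<open>Riesz representation with \<open>T\<close> the identity on \<open>L\<close>: the
  approximating sequence lies in \<open>L\<close>, so closedness puts the representing vector
  there.\<close>

lemma proj_exists:
  fixes L :: "'a::complex_hilbert set"
  assumes L: "csubspace L" "cclosed L"
  shows "\<exists>!y. y \<in> L \<and> (\<forall>z\<in>L. cinner (x - y) z = 0)"
proof -
  obtain g Y where g: "\<And>y. y \<in> L \<Longrightarrow> cinner y g = cinner y x" and Y: "\<And>k. Y k \<in> L" "converges_to Y g"
  proof (rule riesz_range[OF L(1), of "\<lambda>y. y" "\<lambda>y. cinner y x" "cnorm x"])
    show "cmod (cinner y x) \<le> cnorm x * cnorm y" for y
      using cauchy_schwarz[of y x] by (simp add: mult.commute)
  next
    fix g Y
    assume "\<And>y. y \<in> L \<Longrightarrow> cinner y g = cinner y x" "\<And>k. Y k \<in> L" "converges_to Y g"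
    then show thesis by (rule that)
  qed (simp_all add: cinner_simps)
  have gL: "g \<in> L" using L(2) Y unfolding cclosed_def by blast
  have orth: "cinner (x - g) z = 0" if "z \<in> L" for z
    using g[OF that] cinner_cnj[of x z] cinner_cnj[of g z] by (simp add: cinner_simps)
  have uniq: "y = g" if "y \<in> L" "\<forall>z\<in>L. cinner (x - y) z = 0" for y
  proof -
    have mem: "g - y \<in> L" using csubspace_diff[OF L(1) gL that(1)] .
    have "cinner (g - y) (g - y) = cinner (x - y) (g - y) - cinner (x - g) (g - y)"
      by (simp add: cinner_diff_left)
    also have "\<dots> = 0" using bspec[OF that(2) mem] orth[OF mem] by simp
    finally show ?thesis using cinner_eq_zero_iff[of "g - y"] by simp
  qed
  show ?thesis
  proof (rule ex1I)
    show "g \<in> L \<and> (\<forall>z\<in>L. cinner (x - g) z = 0)" using gL orth by blast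
  qed (elim conjE, rule uniq)
qed

lemma
  assumes "csubspace L" "cclosed L"
  shows proj_in: "proj L x \<in> L"
    and proj_orth: "z \<in> L \<Longrightarrow> cinner (x - proj L x) z = 0"
  using theI'[OF proj_exists[OF assms, of x]] unfolding proj_def by blast+

lemma proj_unique:
  "csubspace L \<Longrightarrow> cclosed L \<Longrightarrow> y \<in> L \<Longrightarrow> (\<And>z. z \<in> L \<Longrightarrow> cinner (x - y) z = 0) \<Longrightarrow> proj L x = y"
  unfolding proj_def using proj_exists[of L x] by (intro the1_equality) auto

lemma proj_self: "csubspace L \<Longrightarrow> cclosed L \<Longrightarrow> x \<in> L \<Longrightarrow> proj L x = x"
  by (rule proj_unique) auto

lemma cinner_proj_left:
  "csubspace L \<Longrightarrow> cclosed L \<Longrightarrow> z \<in> L \<Longrightarrow> cinner (proj L x) z = cinner x z"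
  using proj_orth[of L z x] by (simp add: cinner_simps)

lemma proj_diff:
  assumes "csubspace L" "cclosed L"
  shows "proj L (x - y) = proj L x - proj L y"
proof (rule proj_unique[OF assms])
  show "proj L x - proj L y \<in> L" by (intro csubspace_diff proj_in assms)
  show "cinner (x - y - (proj L x - proj L y)) z = 0" if "z \<in> L" for z
    using that by (simp add: assms cinner_diff_left cinner_proj_left)
qed

lemma proj_scaleC:
  assumes "csubspace L" "cclosed L"
  shows "proj L (c *\<^sub>C x) = c *\<^sub>C proj L x"
proof (rule proj_unique[OF assms])
  show "c *\<^sub>C proj L x \<in> L" using proj_in[OF assms] assms(1) by (simp add: csubspace_def)
  show "cinner (c *\<^sub>C x - c *\<^sub>C proj L x) z = 0" if "z \<in> L" for z
    using that by (simp add: assms cinner_diff_left cinner_scaleC_left cinner_proj_left)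
qed

lemma cnorm_proj_le:
  assumes "csubspace L" "cclosed L"
  shows "cnorm (proj L x) \<le> cnorm x"
proof -
  have "Re (cinner x (proj L x)) = (cnorm (proj L x))\<^sup>2"
    by (simp only: cinner_proj_left[OF assms proj_in[OF assms], symmetric] cinner_self Re_complex_of_real)
  then have "(cnorm (x - proj L x))\<^sup>2 = (cnorm x)\<^sup>2 - (cnorm (proj L x))\<^sup>2"
    by (simp add: cnorm_diff_sq)
  then have "(cnorm (proj L x))\<^sup>2 \<le> (cnorm x)\<^sup>2" by (metis diff_ge_0_iff_ge zero_le_power2)
  then show ?thesis by (rule power2_le_imp_le) simp
qed

definition ortho_compl :: "'a::complex_hilbert set \<Rightarrow> 'a set" where
  "ortho_compl K = {x. \<forall>k\<in>K. cinner x k = 0}"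

lemma csubspace_ortho_compl: "csubspace (ortho_compl K)"
  unfolding ortho_compl_def csubspace_def by (simp add: cinner_add_left cinner_scaleC_left)

lemma cclosed_ortho_compl: "cclosed (ortho_compl K)"
proof -
  have "cinner L k = 0" if X: "\<forall>i. X i \<in> ortho_compl K" "converges_to X L" and "k \<in> K" for X L k
  proof -
    have "(\<lambda>i. cinner (X i) k) = (\<lambda>i. 0)" using X(1) \<open>k \<in> K\<close> by (simp add: ortho_compl_def)
    then have "(\<lambda>i. 0) \<longlonglongrightarrow> cinner L k" using tendsto_cinner_left[OF X(2), of k] by simp
    then show ?thesis by (simp add: LIMSEQ_const_iff)
  qed
  then show ?thesis unfolding cclosed_def by (intro allI impI) (subst ortho_compl_def, blast)
qed

lemma proj_ortho_compl:
  assumes "csubspace K" "cclosed K"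
  shows "proj (ortho_compl K) x = x - proj K x"
proof (rule proj_unique[OF csubspace_ortho_compl cclosed_ortho_compl])
  show "x - proj K x \<in> ortho_compl K" by (simp add: ortho_compl_def assms proj_orth)
next
  fix z assume "z \<in> ortho_compl K"
  then have "cinner z (proj K x) = 0" by (simp add: ortho_compl_def assms proj_in)
  then show "cinner (x - (x - proj K x)) z = 0"
    using cinner_cnj[of "proj K x" z] by simp
qed

section \<open>Log-convex sequences and Taylor coefficients\<close>

text \<open>Log-convexity makes the ratios of consecutive terms nondecreasing, so a first ratio
  above \<open>R\<close> would force geometric growth at a rate above \<open>R\<close>. The constant
  \<open>C\<close> disappears from the conclusion.\<close>

lemma log_convex_growth:
  fixes b :: "nat \<Rightarrow> real"
  assumes nonneg: "\<And>n. b n \<ge> 0" and conv: "\<And>n. (b (Suc n))\<^sup>2 \<le> b n * b (Suc (Suc n))"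
    and growth: "\<And>n. b n \<le> C * R ^ n" and "R > 0"
  shows "b (Suc 0) \<le> R * b 0"
proof (rule ccontr)
  assume neg: "\<not> b (Suc 0) \<le> R * b 0"
  have b0: "b 0 > 0"
  proof (rule ccontr)
    assume "\<not> b 0 > 0"
    then have "b 0 = 0" using nonneg[of 0] by linarith
    then show False using conv[of 0] neg by simp
  qed
  define q where "q = b (Suc 0) / b 0"
  have q: "q > R" using neg b0 by (simp add: q_def field_simps)
  have step: "b (Suc n) \<ge> q * b n \<and> b n > 0" for n
  proof (induction n)
    case 0
    then show ?case using b0 by (simp add: q_def)
  next
    case (Suc n)
    have "q * b n > 0" using Suc q \<open>R > 0\<close> by simp
    then have pos: "b (Suc n) > 0" using Suc by linarith
    have "b n * (q * b (Suc n)) \<le> b (Suc n) * b (Suc n)"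
      using mult_right_mono[of "q * b n" "b (Suc n)" "b (Suc n)"] Suc pos by (simp add: mult.commute mult.left_commute)
    also have "\<dots> \<le> b n * b (Suc (Suc n))" using conv[of n] by (simp add: power2_eq_square)
    finally show ?case using Suc pos by simp
  qed
  have lower: "b n \<ge> q ^ n * b 0" for n
  proof (induction n)
    case (Suc n)
    have "q ^ Suc n * b 0 \<le> q * b n" using Suc q \<open>R > 0\<close> by simp
    then show ?case using step[of n] by linarith
  qed simp
  have "q / R > 1" using q \<open>R > 0\<close> by simp
  then obtain n where n: "(q / R) ^ n > C / b 0" using real_arch_pow by blast
  have "C * R ^ n < q ^ n * b 0"
    using n b0 \<open>R > 0\<close> by (simp add: power_divide field_simps)
  then show False using lower[of n] growth[of n] by linarith
qed

lemma higher_deriv_diff_const: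
  fixes a :: complex
  shows "(deriv ^^ n) (\<lambda>w. w - a) = (\<lambda>w. if n = 0 then w - a else if n = 1 then 1 else 0)"
proof (induction n)
  case (Suc n)
  show ?case unfolding funpow.simps o_apply Suc.IH by (cases "n = 0") (auto simp: fun_eq_iff)
qed simp

text \<open>In the Leibniz formula only the term with exactly one derivative on \<open>z - a\<close>
  survives at \<open>a\<close>.\<close>

lemma higher_deriv_linear_mult:
  fixes a :: complex
  assumes "f holomorphic_on S" "open S" "a \<in> S"
  shows "(deriv ^^ Suc n) (\<lambda>z. (z - a) * f z) a = of_nat (Suc n) * (deriv ^^ n) f a"
proof -
  have "(deriv ^^ Suc n) (\<lambda>z. (z - a) * f z) a =
      (\<Sum>i = 0..Suc n. of_nat (Suc n choose i) * (deriv ^^ i) (\<lambda>z. z - a) a * (deriv ^^ (Suc n - i)) f a)"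
    using assms by (intro higher_deriv_mult) (auto intro!: holomorphic_intros)
  also have "\<dots> = (\<Sum>i\<in>{1}. of_nat (Suc n choose i) * (deriv ^^ i) (\<lambda>z. z - a) a * (deriv ^^ (Suc n - i)) f a)"
    by (rule sum.mono_neutral_right) (auto simp: higher_deriv_diff_const simp del: funpow.simps)
  also have "\<dots> = of_nat (Suc n) * (deriv ^^ n) f a"
    by (simp add: higher_deriv_diff_const[of 1, simplified])
  finally show ?thesis .
qed

section \<open>Self-adjoint operators\<close>

text \<open>\<open>maximal\<close> places every pair \<open>(g, h)\<close> of the adjoint relation
  in the graph of \<open>A\<close>; with symmetry this expresses self-adjointness in a form that
  applies directly to Riesz vectors.\<close>

locale sa_operator =
  fixes D :: "'a::complex_hilbert set" and A :: "'a \<Rightarrow> 'a"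
  assumes subspace: "csubspace D"
    and add: "x \<in> D \<Longrightarrow> y \<in> D \<Longrightarrow> A (x + y) = A x + A y"
    and scale: "x \<in> D \<Longrightarrow> A (c *\<^sub>C x) = c *\<^sub>C A x"
    and sym: "x \<in> D \<Longrightarrow> y \<in> D \<Longrightarrow> cinner (A x) y = cinner x (A y)"
    and maximal: "(\<And>y. y \<in> D \<Longrightarrow> cinner (A y) g = cinner y h) \<Longrightarrow> g \<in> D \<and> A g = h"
begin

definition shift :: "complex \<Rightarrow> 'a \<Rightarrow> 'a" where
  "shift z y = A y - z *\<^sub>C y"

lemma D_zero: "0 \<in> D"
  and D_add: "x \<in> D \<Longrightarrow> y \<in> D \<Longrightarrow> x + y \<in> D"
  and D_scale: "x \<in> D \<Longrightarrow> c *\<^sub>C x \<in> D"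
  using subspace by (simp_all add: csubspace_def)

lemma D_diff: "x \<in> D \<Longrightarrow> y \<in> D \<Longrightarrow> x - y \<in> D"
  by (rule csubspace_diff[OF subspace])

lemma diff: "x \<in> D \<Longrightarrow> y \<in> D \<Longrightarrow> A (x - y) = A x - A y"
  using add[OF D_diff[of x y], of y] by simp

lemma shift_add: "x \<in> D \<Longrightarrow> y \<in> D \<Longrightarrow> shift z (x + y) = shift z x + shift z y"
  by (simp add: shift_def add scaleC_add_right)

lemma shift_diff: "x \<in> D \<Longrightarrow> y \<in> D \<Longrightarrow> shift z (x - y) = shift z x - shift z y"
  by (simp add: shift_def diff scaleC_diff_right)

lemma shift_scale: "x \<in> D \<Longrightarrow> shift z (c *\<^sub>C x) = c *\<^sub>C shift z x"
  by (simp add: shift_def scale scaleC_diff_right scaleC_scaleC mult.commute)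

lemma shift_zero: "shift z 0 = 0"
  using shift_scale[OF D_zero, of z 0] by simp

lemma shift_change: "shift z y = shift w y + (w - z) *\<^sub>C y"
  by (simp add: shift_def scaleC_diff_left)

lemma shift_sym: "x \<in> D \<Longrightarrow> y \<in> D \<Longrightarrow> cinner (shift z x) y = cinner x (shift (cnj z) y)"
  by (simp add: shift_def cinner_simps sym)

text \<open>The adjoint of \<open>A - cnj z\<close> is \<open>A - z\<close>. In this form vectors
  obtained by Riesz representation or as weak limits are recognised as elements of
  \<open>D\<close>.\<close>

lemma shift_maximal:
  assumes "\<And>y. y \<in> D \<Longrightarrow> cinner (shift (cnj z) y) g = cinner y h"
  shows "g \<in> D" and "shift z g = h"
proof -
  have "g \<in> D \<and> A g = h + z *\<^sub>C g"
    by (rule maximal) (use assms in \<open>simp add: shift_def cinner_simps algebra_simps\<close>)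
  then show "g \<in> D" "shift z g = h" by (auto simp: shift_def)
qed

lemma cnorm_shift_le: "cnorm (shift z y) \<le> cnorm (shift w y) + cmod (w - z) * cnorm y"
  using cnorm_triangle[of "shift w y" "(w - z) *\<^sub>C y"] by (simp add: shift_change[of z y w] cnorm_scaleC)

text \<open>Symmetry makes the inner product of \<open>(A - Re z) y\<close> with \<open>y\<close>
  real, so the cross term with an imaginary multiple of \<open>y\<close> has no real part.\<close>

lemma cnorm_shift_sq:
  assumes "y \<in> D"
  shows "(cnorm (shift z y))\<^sup>2 = (cnorm (shift (complex_of_real (Re z)) y))\<^sup>2 + (Im z)\<^sup>2 * (cnorm y)\<^sup>2"
proof -
  let ?s = "shift (complex_of_real (Re z)) y"
  let ?c = "\<i> * complex_of_real (Im z)"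
  have "cinner ?s y = cnj (cinner ?s y)"
    using shift_sym[OF assms assms, of "complex_of_real (Re z)"] cinner_cnj[of y ?s] by simp
  from arg_cong[OF this, of Im] have im: "Im (cinner ?s y) = 0" by simp
  have "shift z y = ?s - ?c *\<^sub>C y"
    by (simp add: shift_def scaleC_add_left[symmetric] diff_diff_eq complex_eq[symmetric])
  moreover have "Re (cinner ?s (?c *\<^sub>C y)) = 0" using im by (simp add: cinner_scaleC_right)
  ultimately show ?thesis
    by (simp add: cnorm_diff_sq cnorm_scaleC norm_mult power_mult_distrib)
qed

lemma cnorm_shift_cnj: "y \<in> D \<Longrightarrow> cnorm (shift (cnj z) y) = cnorm (shift z y)"
  by (rule power2_eq_imp_eq) (simp_all add: cnorm_shift_sq[of y z] cnorm_shift_sq[of y "cnj z"])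

lemma cnorm_shift_Re_le: "y \<in> D \<Longrightarrow> cnorm (shift (complex_of_real (Re z)) y) \<le> cnorm (shift z y)"
  by (rule power2_le_imp_le) (simp_all add: cnorm_shift_sq[of y z])

lemma cnorm_shift_Im_le: "y \<in> D \<Longrightarrow> \<bar>Im z\<bar> * cnorm y \<le> cnorm (shift z y)"
  by (rule power2_le_imp_le) (simp_all add: cnorm_shift_sq[of y z] power_mult_distrib)

section \<open>Lower bounds and the spectrum\<close>

definition bounded_below :: "complex \<Rightarrow> bool" where
  "bounded_below z \<longleftrightarrow> (\<exists>C>0. \<forall>y\<in>D. cnorm y \<le> C * cnorm (shift z y))"

lemma bounded_belowI:
  assumes "\<And>y. y \<in> D \<Longrightarrow> cnorm y \<le> C * cnorm (shift z y)"
  shows "bounded_below z"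
proof -
  have "cnorm y \<le> (\<bar>C\<bar> + 1) * cnorm (shift z y)" if "y \<in> D" for y
  proof -
    have "C * cnorm (shift z y) \<le> (\<bar>C\<bar> + 1) * cnorm (shift z y)" by (intro mult_right_mono) auto
    then show ?thesis using assms[OF that] by linarith
  qed
  moreover have "\<bar>C\<bar> + 1 > 0" by linarith
  ultimately show ?thesis unfolding bounded_below_def by blast
qed

lemma bounded_below_inj: "bounded_below z \<Longrightarrow> y \<in> D \<Longrightarrow> shift z y = 0 \<Longrightarrow> y = 0"
  unfolding bounded_below_def using cnorm_ge_zero[of y] cnorm_eq_zero[of y]
  by (metis cnorm_zero mult_zero_right order_antisym)

lemma bounded_below_nonreal: "Im z \<noteq> 0 \<Longrightarrow> bounded_below z"
  by (rule bounded_belowI[of "1 / \<bar>Im z\<bar>"])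
     (use cnorm_shift_Im_le[of _ z] in \<open>simp add: field_simps\<close>)

text \<open>The functional given by \<open>f\<close> is represented through
  \<open>A - cnj z\<close>, which has the same lower bound as \<open>A - z\<close>; maximality turns
  the representing vector into a solution.\<close>

lemma bounded_below_surj:
  assumes "bounded_below z"
  obtains x where "x \<in> D" and "shift z x = f"
proof -
  obtain C where C: "C > 0" "\<And>y. y \<in> D \<Longrightarrow> cnorm y \<le> C * cnorm (shift z y)"
    using assms unfolding bounded_below_def by blast
  obtain g where g: "\<And>y. y \<in> D \<Longrightarrow> cinner (shift (cnj z) y) g = cinner y f"
  proof (rule riesz_range[OF subspace, of "shift (cnj z)" "\<lambda>y. cinner y f" "C * cnorm f"])
    fix y assume y: "y \<in> D"
    have "cmod (cinner y f) \<le> cnorm y * cnorm f" by (rule cauchy_schwarz)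
    also have "\<dots> \<le> C * cnorm (shift (cnj z) y) * cnorm f"
      by (intro mult_right_mono) (simp_all add: C(2)[OF y] cnorm_shift_cnj[OF y])
    finally show "cmod (cinner y f) \<le> C * cnorm f * cnorm (shift (cnj z) y)"
      by (simp add: mult_ac)
  next
    fix g Y assume "\<And>y. y \<in> D \<Longrightarrow> cinner (shift (cnj z) y) g = cinner y f"
    then show thesis by (rule that)
  qed (use C(1) in \<open>simp_all add: shift_add shift_scale cinner_simps\<close>)
  show thesis using that[of g] shift_maximal[of z g f] g by blast
qed

text \<open>By self-adjointness a lower bound already yields bijectivity, so it alone decides
  membership in the resolvent set.\<close>

lemma spectrum_iff: "z \<in> spectrum_op (D, A) \<longleftrightarrow> \<not> bounded_below z"
proof -
  have "z \<in> resolvent_set (D, A) \<longleftrightarrow> bounded_below z"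
  proof
    assume "z \<in> resolvent_set (D, A)"
    then obtain C where "\<forall>x\<in>D. cnorm x \<le> C * cnorm (shift z x)"
      by (auto simp: resolvent_set_def dom_def app_def shift_def)
    then show "bounded_below z" using bounded_belowI by blast
  next
    assume bb: "bounded_below z"
    then obtain C where C: "\<forall>x\<in>D. cnorm x \<le> C * cnorm (shift z x)"
      unfolding bounded_below_def by blast
    have "\<exists>!x. x \<in> D \<and> shift z x = y" for y
    proof -
      obtain x where x: "x \<in> D" "shift z x = y" using bounded_below_surj[OF bb] by blast
      have "x' = x" if "x' \<in> D" "shift z x' = y" for x'
        using bounded_below_inj[OF bb D_diff[OF that(1) x(1)]] x that by (simp add: shift_diff)
      then show ?thesis using x by blast
    qed
    then show "z \<in> resolvent_set (D, A)"
      using C by (auto simp: resolvent_set_def dom_def app_def shift_def)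
  qed
  then show ?thesis by (simp add: spectrum_op_def)
qed

lemma spectrum_real: "z \<in> spectrum_op (D, A) \<Longrightarrow> z = complex_of_real (Re z)"
  using bounded_below_nonreal[of z] by (auto simp: spectrum_iff complex_eq_iff)

text \<open>A lower bound with constant \<open>C\<close> at \<open>z\<close> persists with
  \<open>2 * C\<close> on the disc of radius \<open>1 / (2 * C)\<close>.\<close>

lemma closed_spectrum: "closed (spectrum_op (D, A))"
  unfolding closed_def
proof (rule openI)
  fix z assume "z \<in> - spectrum_op (D, A)"
  then obtain C where C: "C > 0" "\<And>y. y \<in> D \<Longrightarrow> cnorm y \<le> C * cnorm (shift z y)"
    by (auto simp: spectrum_iff bounded_below_def)
  have "bounded_below w" if "dist z w < 1 / (2 * C)" for w
  proof (rule bounded_belowI)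
    fix y assume y: "y \<in> D"
    have "cmod (w - z) * cnorm y \<le> 1 / (2 * C) * cnorm y"
      using that by (intro mult_right_mono) (simp_all add: dist_norm norm_minus_commute)
    then have "cnorm (shift z y) \<le> cnorm (shift w y) + 1 / (2 * C) * cnorm y"
      using cnorm_shift_le[of z y w] by linarith
    then have "C * cnorm (shift z y) \<le> C * (cnorm (shift w y) + 1 / (2 * C) * cnorm y)"
      using C(1) by (intro mult_left_mono) simp_all
    also have "\<dots> = C * cnorm (shift w y) + cnorm y / 2" using C(1) by (simp add: field_simps)
    finally show "cnorm y \<le> (2 * C) * cnorm (shift w y)" using C(2)[OF y] by simp
  qed
  then show "\<exists>e>0. ball z e \<subseteq> - spectrum_op (D, A)"
    using C(1) by (intro exI[of _ "1 / (2 * C)"]) (auto simp: spectrum_iff)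
qed

text \<open>If both \<open>x + m\<close> and \<open>x - m\<close> were in the resolvent set, then so would be \<open>m\<^sup>2\<close> for
  \<open>(A - x)\<^sup>2\<close>, and the infimum \<open>m\<close> could be increased.\<close>

lemma nearest_spectrum:
  fixes x :: real
  assumes nontriv: "y0 \<in> D" "y0 \<noteq> 0"
  obtains m s where "m \<ge> 0" and "complex_of_real s \<in> spectrum_op (D, A)" and "\<bar>s - x\<bar> = m"
    and "\<And>y. y \<in> D \<Longrightarrow> m * cnorm y \<le> cnorm (shift (complex_of_real x) y)"
proof -
  let ?S = "shift (complex_of_real x)"
  define Q where "Q = (\<lambda>y. cnorm (?S y) / cnorm y) ` (D - {0})"
  define m where "m = Inf Q"
  have Q_nonneg: "q \<ge> 0" if "q \<in> Q" for q using that by (auto simp: Q_def)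
  have Q_ne: "Q \<noteq> {}" using nontriv by (auto simp: Q_def)
  have m_ge: "c \<le> m" if "\<And>y. y \<in> D \<Longrightarrow> c * cnorm y \<le> cnorm (?S y)" for c
    unfolding m_def
  proof (rule cInf_greatest[OF Q_ne])
    fix q assume "q \<in> Q"
    then obtain y where y: "y \<in> D" "y \<noteq> 0" "q = cnorm (?S y) / cnorm y" by (auto simp: Q_def)
    then have "cnorm y > 0" by (simp add: less_le)
    then show "c \<le> q" using that[OF y(1)] y(3) by (simp add: field_simps)
  qed
  have m0: "m \<ge> 0" by (rule m_ge) simp
  have m_le: "m * cnorm y \<le> cnorm (?S y)" if "y \<in> D" for y
  proof (cases "y = 0")
    case False
    then have "cnorm y > 0" by (simp add: less_le)
    moreover have "m \<le> cnorm (?S y) / cnorm y"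
      unfolding m_def using that False Q_nonneg
      by (intro cInf_lower) (auto simp: Q_def intro!: bdd_belowI[of _ 0])
    ultimately show ?thesis by (simp add: field_simps)
  qed simp
  have "\<not> (bounded_below (complex_of_real (x + m)) \<and> bounded_below (complex_of_real (x - m)))"
  proof
    assume bb: "bounded_below (complex_of_real (x + m)) \<and> bounded_below (complex_of_real (x - m))"
    then obtain C1 C2 where
      C1: "C1 > 0" "\<And>y. y \<in> D \<Longrightarrow> cnorm y \<le> C1 * cnorm (shift (complex_of_real (x + m)) y)" and
      C2: "C2 > 0" "\<And>y. y \<in> D \<Longrightarrow> cnorm y \<le> C2 * cnorm (shift (complex_of_real (x - m)) y)"
      unfolding bounded_below_def by blast
    \<comment> \<open>For \<open>m = 0\<close> the point \<open>x + m\<close> is \<open>x\<close>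
      itself, and its lower bound contradicts the infimum being \<open>0\<close>.\<close>
    have "m \<noteq> 0"
    proof
      assume "m = 0"
      then have "1 / C1 \<le> m" using C1 by (intro m_ge) (simp add: field_simps)
      then show False using \<open>m = 0\<close> C1(1) by simp
    qed
    then have m: "m > 0" using m0 by simp
    have bbx: "bounded_below (complex_of_real x)"
      by (rule bounded_belowI[of "1 / m"]) (use m m_le in \<open>simp add: field_simps\<close>)
    \<comment> \<open>Chosen so that \<open>cnorm y \<le> c * cnorm w\<close> will hold for the
      \<open>w\<close> below; \<open>k\<close> is the resulting gain over
      \<open>m\<^sup>2\<close>.\<close>
    define c where "c = (m + 1) * C1 * C2"
    have c: "c > 0" using m C1(1) C2(1) by (simp add: c_def)
    define k where "k = 1 / c\<^sup>2"
    have k: "k > 0" using c by (simp add: k_def)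
    have key: "(m\<^sup>2 + k) * (cnorm y)\<^sup>2 \<le> (cnorm (?S y))\<^sup>2"
      if y: "y \<in> D" and small: "cnorm (?S y) \<le> (m + 1) * cnorm y" for y
    proof -
      obtain t where t: "t \<in> D" "?S t = y" using bounded_below_surj[OF bbx] by blast
      define p where "p = shift (complex_of_real (x + m)) t"
      have p: "p = y - complex_of_real m *\<^sub>C t"
        by (simp add: p_def shift_def scaleC_add_left t(2)[unfolded shift_def, symmetric])
      have pD: "p \<in> D" unfolding p by (intro D_diff D_scale y t(1))
      \<comment> \<open>With \<open>?S t = y\<close> this is
        \<open>(?S\<^sup>2 - m\<^sup>2) t\<close>, the two regular shifts applied in succession to
        \<open>t\<close>. Their lower bounds control \<open>t\<close> by \<open>w\<close>, while
        expanding the square and \<open>m * cnorm t \<le> cnorm y\<close> bound \<open>w\<close> by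
        the excess of \<open>(cnorm (?S y))\<^sup>2\<close> over
        \<open>m\<^sup>2 * (cnorm y)\<^sup>2\<close>.\<close>
      define w where "w = ?S y - complex_of_real (m\<^sup>2) *\<^sub>C t"
      have "shift (complex_of_real (x - m)) p = ?S p + complex_of_real m *\<^sub>C p"
        using shift_change[of "complex_of_real (x - m)" p "complex_of_real x"] by simp
      also have "?S p = ?S y - complex_of_real m *\<^sub>C y"
        unfolding p by (simp add: shift_diff shift_scale D_scale y t)
      also have "?S y - complex_of_real m *\<^sub>C y + complex_of_real m *\<^sub>C p = w"
        by (simp add: p w_def scaleC_diff_right scaleC_scaleC power2_eq_square)
      finally have sp: "shift (complex_of_real (x - m)) p = w" .
      have "cnorm t \<le> C1 * cnorm p" using C1(2)[OF t(1)] by (simp add: p_def)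
      also have "\<dots> \<le> C1 * (C2 * cnorm w)" using C2(2)[OF pD] C1(1) sp by (intro mult_left_mono) auto
      finally have tw: "cnorm t \<le> C1 * C2 * cnorm w" by (simp add: mult.assoc)
      have "cinner (?S y) t = cinner y y" using shift_sym[OF y t(1), of "complex_of_real x"] t(2) by simp
      then have yy: "cinner (?S y) t = complex_of_real ((cnorm y)\<^sup>2)" by (simp only: cinner_self)
      have mt: "m * cnorm t \<le> cnorm y" using m_le[OF t(1)] t(2) by simp
      have "(m * cnorm t)\<^sup>2 \<le> (cnorm y)\<^sup>2" using mt m0 by (intro power_mono) auto
      then have mt2: "m\<^sup>2 * (m * cnorm t)\<^sup>2 \<le> m\<^sup>2 * (cnorm y)\<^sup>2" by (intro mult_left_mono) auto
      have "cnorm (complex_of_real (m\<^sup>2) *\<^sub>C t) = m * (m * cnorm t)"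
        by (simp add: cnorm_scaleC power2_eq_square norm_mult m0)
      then have "(cnorm w)\<^sup>2 = (cnorm (?S y))\<^sup>2 - 2 * (m\<^sup>2 * (cnorm y)\<^sup>2) + m\<^sup>2 * (m * cnorm t)\<^sup>2"
        by (simp add: w_def cnorm_diff_sq cinner_scaleC_right yy power_mult_distrib flip: of_real_power of_real_mult)
      then have ww: "(cnorm w)\<^sup>2 \<le> (cnorm (?S y))\<^sup>2 - m\<^sup>2 * (cnorm y)\<^sup>2" using mt2 by linarith
      have "(cnorm y)\<^sup>2 = cmod (cinner (?S y) t)" unfolding yy by (simp add: norm_power)
      also have "\<dots> \<le> cnorm (?S y) * cnorm t" by (rule cauchy_schwarz)
      also have "\<dots> \<le> (m + 1) * cnorm y * cnorm t" using small by (intro mult_right_mono) auto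
      finally have "cnorm y * cnorm y \<le> cnorm y * ((m + 1) * cnorm t)"
        by (simp add: power2_eq_square mult_ac)
      then have "cnorm y \<le> (m + 1) * cnorm t"
        using m0 by (cases "y = 0") (auto simp: less_le)
      also have "\<dots> \<le> (m + 1) * (C1 * C2 * cnorm w)" using tw m0 by (intro mult_left_mono) auto
      finally have "cnorm y \<le> c * cnorm w" by (simp add: c_def mult.assoc)
      then have "(cnorm y)\<^sup>2 \<le> (c * cnorm w)\<^sup>2" by (intro power_mono) auto
      then have "k * (cnorm y)\<^sup>2 \<le> (cnorm w)\<^sup>2"
        using c by (simp add: k_def power_mult_distrib divide_le_eq mult.commute)
      then show ?thesis using ww by (simp add: distrib_right)
    qed
    \<comment> \<open>The minimum with \<open>m + 1\<close> takes care of the vectors to which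
      \<open>key\<close> does not apply. As a lower bound exceeding \<open>m\<close>, this
      \<open>d\<close> contradicts the choice of \<open>m\<close>.\<close>
    define d where "d = min (m + 1) (sqrt (m\<^sup>2 + k))"
    have d0: "d \<ge> 0" using m0 k by (simp add: d_def)
    have d2: "d\<^sup>2 \<le> m\<^sup>2 + k"
      using power_mono[of d "sqrt (m\<^sup>2 + k)" 2] d0 k by (simp add: d_def)
    have "d \<le> m"
    proof (rule m_ge)
      fix y assume y: "y \<in> D"
      show "d * cnorm y \<le> cnorm (?S y)"
      proof (cases "cnorm (?S y) \<le> (m + 1) * cnorm y")
        case True
        have "d\<^sup>2 * (cnorm y)\<^sup>2 \<le> (m\<^sup>2 + k) * (cnorm y)\<^sup>2" using d2 by (intro mult_right_mono) auto
        then have "(d * cnorm y)\<^sup>2 \<le> (cnorm (?S y))\<^sup>2"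
          using key[OF y True] by (simp add: power_mult_distrib)
        then show ?thesis by (rule power2_le_imp_le) simp
      next
        case False
        have "d * cnorm y \<le> (m + 1) * cnorm y" by (intro mult_right_mono) (auto simp: d_def)
        then show ?thesis using False by linarith
      qed
    qed
    moreover have "sqrt (m\<^sup>2 + k) > m" using k m0 by (intro real_less_rsqrt) simp
    ultimately show False by (simp add: d_def min_def split: if_splits)
  qed
  then consider "complex_of_real (x + m) \<in> spectrum_op (D, A)" | "complex_of_real (x - m) \<in> spectrum_op (D, A)"
    by (auto simp: spectrum_iff)
  then show thesis
  proof cases
    case 1
    then show thesis by (rule that[OF m0 _ _ m_le]) (simp add: m0)
  next
    case 2
    then show thesis by (rule that[OF m0 _ _ m_le]) (simp add: m0)
  qed
qed

section \<open>Spectral subspaces away from a point\<close>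

text \<open>\<open>h n\<close> plays the role of the \<open>n\<close>-th inverse power of
  \<open>A - x\<close> at \<open>h 0\<close>; no inverse is assumed to exist, each member is just a
  preimage of the one before.\<close>

definition chain :: "real \<Rightarrow> real \<Rightarrow> real \<Rightarrow> (nat \<Rightarrow> 'a) \<Rightarrow> bool" where
  "chain x R C h \<longleftrightarrow> (\<forall>n. h (Suc n) \<in> D \<and> shift (complex_of_real x) (h (Suc n)) = h n \<and>
     cnorm (h n) \<le> C * R ^ n)"

text \<open>The spectral subspace of \<open>A\<close> for \<open>{t. \<bar>t - x\<bar> \<ge> 1 / R}\<close>.\<close>
definition spec_sub :: "real \<Rightarrow> real \<Rightarrow> 'a set" where
  "spec_sub x R = {f. \<exists>C h. chain x R C h \<and> h 0 = f}"

text \<open>By symmetry \<open>(cnorm (h (Suc n)))\<^sup>2\<close> is the inner product of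
  \<open>h n\<close> and \<open>h (Suc (Suc n))\<close>, so the norms are log-convex and growth of
  order \<open>R ^ n\<close> limits every single step to the factor \<open>R\<close>.\<close>

lemma chain_step:
  assumes "chain x R C h" "R > 0"
  shows "cnorm (h (Suc n)) \<le> R * cnorm (h n)"
proof -
  have "cnorm (h (Suc 0 + n)) \<le> R * cnorm (h (0 + n))"
  proof (rule log_convex_growth[of "\<lambda>k. cnorm (h (k + n))" "C * R ^ n" R])
    fix k
    have h: "h (Suc j) \<in> D" "shift (complex_of_real x) (h (Suc j)) = h j" for j
      using assms by (auto simp: chain_def)
    let ?j = "k + n"
    have "cinner (h ?j) (h (Suc (Suc ?j))) = cinner (h (Suc ?j)) (h (Suc ?j))"
      using shift_sym[OF h(1)[of ?j] h(1)[of "Suc ?j"], of "complex_of_real x"] by (simp add: h)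
    then have "complex_of_real ((cnorm (h (Suc ?j)))\<^sup>2) = cinner (h ?j) (h (Suc (Suc ?j)))"
      by (simp only: cinner_self)
    from arg_cong[OF this, of cmod]
    have "(cnorm (h (Suc ?j)))\<^sup>2 = cmod (cinner (h ?j) (h (Suc (Suc ?j))))" by (simp add: norm_power)
    also have "\<dots> \<le> cnorm (h ?j) * cnorm (h (Suc (Suc ?j)))" by (rule cauchy_schwarz)
    finally show "(cnorm (h (Suc k + n)))\<^sup>2 \<le> cnorm (h (k + n)) * cnorm (h (Suc (Suc k) + n))" by simp
  next
    show "cnorm (h (k + n)) \<le> C * R ^ n * R ^ k" for k
    proof -
      have "cnorm (h (k + n)) \<le> C * R ^ (k + n)" using assms(1) unfolding chain_def by blast
      then show ?thesis by (simp add: power_add mult_ac)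
    qed
  qed (use assms(2) in auto)
  then show ?thesis by simp
qed

text \<open>The norm of the starting vector replaces the unspecified \<open>C\<close>. Applied to
  differences of chains, this makes a chain depend continuously on its start.\<close>

lemma chain_bound:
  assumes "chain x R C h" "R > 0"
  shows "cnorm (h n) \<le> cnorm (h 0) * R ^ n"
proof (induction n)
  case (Suc n)
  have "cnorm (h (Suc n)) \<le> R * cnorm (h n)" by (rule chain_step[OF assms])
  also have "\<dots> \<le> R * (cnorm (h 0) * R ^ n)" using Suc assms(2) by (intro mult_left_mono) auto
  finally show ?case by (simp add: mult_ac)
qed simp

lemma chain_add:
  assumes "chain x R C h" "chain x R C' h'"
  shows "chain x R (C + C') (\<lambda>n. h n + h' n)"
  unfolding chain_def
proof (intro allI conjI)
  fix n
  show "h (Suc n) + h' (Suc n) \<in> D" "shift (complex_of_real x) (h (Suc n) + h' (Suc n)) = h n + h' n"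
    using assms by (auto simp: chain_def D_add shift_add)
  have "cnorm (h n) \<le> C * R ^ n" "cnorm (h' n) \<le> C' * R ^ n" using assms by (auto simp: chain_def)
  then show "cnorm (h n + h' n) \<le> (C + C') * R ^ n"
    using cnorm_triangle[of "h n" "h' n"] by (simp add: distrib_right)
qed

lemma chain_scale:
  assumes "chain x R C h"
  shows "chain x R (cmod c * C) (\<lambda>n. c *\<^sub>C h n)"
  using assms by (auto simp: chain_def D_scale shift_scale cnorm_scaleC mult.assoc intro!: mult_left_mono)

lemma csubspace_spec_sub: "csubspace (spec_sub x R)"
  unfolding csubspace_def
proof (intro conjI ballI allI)
  have "chain x R 0 (\<lambda>n. 0)" by (simp add: chain_def D_zero shift_zero)
  then show "0 \<in> spec_sub x R" unfolding spec_sub_def by blast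
next
  fix f f' assume "f \<in> spec_sub x R" "f' \<in> spec_sub x R"
  then obtain C h C' h' where "chain x R C h" "h 0 = f" "chain x R C' h'" "h' 0 = f'"
    unfolding spec_sub_def by blast
  then show "f + f' \<in> spec_sub x R" using chain_add unfolding spec_sub_def by blast
next
  fix c f assume "f \<in> spec_sub x R"
  then obtain C h where "chain x R C h" "h 0 = f" unfolding spec_sub_def by blast
  then show "c *\<^sub>C f \<in> spec_sub x R" using chain_scale unfolding spec_sub_def by blast
qed

text \<open>A chain without its first member is again a chain. Hence \<open>A - x\<close> maps the
  part of \<open>D\<close> in the spectral subspace onto that subspace, with solutions bounded by
  the factor \<open>R\<close>.\<close>

lemma spec_sub_solve:
  assumes "f \<in> spec_sub x R" "R > 0"
  obtains t where "t \<in> D" "t \<in> spec_sub x R" "shift (complex_of_real x) t = f" "cnorm t \<le> R * cnorm f"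
proof -
  obtain C h where h: "chain x R C h" "h 0 = f" using assms(1) unfolding spec_sub_def by blast
  have "chain x R (C * R) (\<lambda>n. h (Suc n))"
    using h(1) unfolding chain_def by (metis mult.assoc power_Suc)
  then have "h (Suc 0) \<in> spec_sub x R" unfolding spec_sub_def by blast
  moreover have "h (Suc 0) \<in> D" "shift (complex_of_real x) (h (Suc 0)) = f"
    using h by (auto simp: chain_def)
  moreover have "cnorm (h (Suc 0)) \<le> R * cnorm f" using chain_step[OF h(1) assms(2), of 0] h(2) by simp
  ultimately show thesis using that by blast
qed

text \<open>Differences of chains are chains, so for each \<open>n\<close> the \<open>n\<close>-th
  members of the chains starting at \<open>X j\<close> are Cauchy. Their limits again form a chain,
  because maximality makes \<open>A\<close> closed.\<close>

lemma cclosed_spec_sub: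
  assumes "R > 0"
  shows "cclosed (spec_sub x R)"
proof -
  have "f \<in> spec_sub x R" if X: "\<And>j. X j \<in> spec_sub x R" "converges_to X f" for X f
  proof -
    have "\<forall>j. \<exists>h C. chain x R C h \<and> h 0 = X j" using X(1) unfolding spec_sub_def by blast
    then obtain h where "\<forall>j. \<exists>C. chain x R C (h j) \<and> h j 0 = X j" by metis
    then obtain C where h: "\<And>j. chain x R (C j) (h j)" "\<And>j. h j 0 = X j" by metis
    have hD: "h j (Suc n) \<in> D" "shift (complex_of_real x) (h j (Suc n)) = h j n" for j n
      using h(1)[of j] by (auto simp: chain_def)
    have diff: "cnorm (h i n - h j n) \<le> cnorm (X i - X j) * R ^ n" for i j n
    proof -
      have "chain x R (C i + cmod (- 1) * C j) (\<lambda>n. h i n + (- 1) *\<^sub>C h j n)"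
        by (intro chain_add chain_scale h)
      from chain_bound[OF this assms, of n] show ?thesis by (simp add: h(2) scaleC_minus_one)
    qed
    have "\<exists>L. converges_to (\<lambda>j. h j n) L" for n
    proof (rule cauchy_converges)
      fix e :: real assume "e > 0"
      then have pos: "e / (2 * R ^ n) > 0" using assms by simp
      then obtain N where N: "\<And>j. j \<ge> N \<Longrightarrow> cnorm (X j - f) < e / (2 * R ^ n)"
        using X(2) unfolding converges_to_def lim_sequentially by (auto simp: dist_real_def)
      have "cnorm (h i n - h j n) < e" if "i \<ge> N" "j \<ge> N" for i j
      proof -
        have "cnorm (X i - X j) < e / (2 * R ^ n) + e / (2 * R ^ n)"
          using cnorm_triangle_diff[of "X i" "X j" f] N[OF that(1)] N[OF that(2)]
            cnorm_minus_commute[of f "X j"] by linarith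
        then have "cnorm (X i - X j) < e / R ^ n" by simp
        then have "cnorm (X i - X j) * R ^ n < e" using assms by (simp add: field_simps)
        then show ?thesis using diff[of i n j] by linarith
      qed
      then show "\<exists>N. \<forall>m\<ge>N. \<forall>k\<ge>N. cnorm (h m n - h k n) < e" by blast
    qed
    then obtain g where g: "\<And>n. converges_to (\<lambda>j. h j n) (g n)" by metis
    have g0: "g 0 = f"
    proof -
      have "cinner (g 0) v = cinner f v" for v
        using LIMSEQ_unique[OF tendsto_cinner_left[OF g[of 0], of v]]
          tendsto_cinner_left[OF X(2), of v] by (simp add: h(2))
      then have "cinner (g 0 - f) (g 0 - f) = 0" by (simp add: cinner_diff_left)
      then show ?thesis using cinner_eq_zero_iff[of "g 0 - f"] by simp
    qed
    have gS: "g (Suc n) \<in> D \<and> shift (complex_of_real x) (g (Suc n)) = g n" for n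
    proof -
      have eq: "cinner (shift (cnj (complex_of_real x)) y) (g (Suc n)) = cinner y (g n)" if y: "y \<in> D" for y
      proof (rule LIMSEQ_unique)
        show "(\<lambda>j. cinner y (h j n)) \<longlonglongrightarrow> cinner y (g n)" by (rule tendsto_cinner_right[OF g])
        have "cinner y (h j n) = cinner (shift (cnj (complex_of_real x)) y) (h j (Suc n))" for j
          using shift_sym[OF y hD(1)[of j n], of "complex_of_real x"] by (simp add: hD)
        then show "(\<lambda>j. cinner y (h j n)) \<longlonglongrightarrow>
            cinner (shift (cnj (complex_of_real x)) y) (g (Suc n))"
          using tendsto_cinner_right[OF g] by simp
      qed
      show ?thesis using shift_maximal[OF eq] by blast
    qed
    have "cnorm (g n) \<le> cnorm f * R ^ n" for n
    proof (rule tendsto_le[OF sequentially_bot])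
      show "(\<lambda>j. cnorm (h j n)) \<longlonglongrightarrow> cnorm (g n)" by (rule tendsto_cnorm[OF g])
      show "(\<lambda>j. cnorm (X j) * R ^ n) \<longlonglongrightarrow> cnorm f * R ^ n"
        by (intro tendsto_mult tendsto_const tendsto_cnorm X)
      show "\<forall>\<^sub>F j in sequentially. cnorm (h j n) \<le> cnorm (X j) * R ^ n"
        using chain_bound[OF h(1) assms] by (simp add: h(2))
    qed
    then have "chain x R (cnorm f) g" using gS by (simp add: chain_def)
    then show ?thesis using g0 unfolding spec_sub_def by blast
  qed
  then show ?thesis unfolding cclosed_def by blast
qed

text \<open>The spectral subspace \<open>K\<close> reduces \<open>A\<close>. The projection of
  \<open>y\<close> is the \<open>t\<close> in \<open>K\<close> whose image under
  \<open>A - x\<close> is the projection of \<open>(A - x) y\<close>; orthogonality of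
  \<open>y - t\<close> to \<open>K\<close> follows by writing each \<open>k\<close> in
  \<open>K\<close> as \<open>(A - x) k'\<close> with \<open>k'\<close> in \<open>K\<close>.\<close>

lemma proj_spec_sub:
  assumes y: "y \<in> D" and R: "R > 0"
  shows "proj (spec_sub x R) y \<in> D"
    and "shift (complex_of_real x) (proj (spec_sub x R) y)
       = proj (spec_sub x R) (shift (complex_of_real x) y)"
proof -
  let ?K = "spec_sub x R" and ?S = "shift (complex_of_real x)"
  note K = csubspace_spec_sub[of x R] cclosed_spec_sub[OF R, of x]
  obtain t where t: "t \<in> D" "t \<in> ?K" "?S t = proj ?K (?S y)"
    using spec_sub_solve[OF proj_in[OF K] R] by metis
  have "proj ?K y = t"
  proof (rule proj_unique[OF K t(2)])
    fix k assume "k \<in> ?K"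
    then obtain k' where k': "k' \<in> D" "k' \<in> ?K" "?S k' = k" using spec_sub_solve[OF _ R] by metis
    have "cinner y k = cinner (?S y) k'"
      using shift_sym[OF y k'(1), of "complex_of_real x"] k'(3) by simp
    also have "\<dots> = cinner (?S t) k'" using t(3) cinner_proj_left[OF K k'(2)] by simp
    also have "\<dots> = cinner t k"
      using shift_sym[OF t(1) k'(1), of "complex_of_real x"] k'(3) by simp
    finally show "cinner (y - t) k = 0" by (simp add: cinner_diff_left)
  qed
  then show "proj ?K y \<in> D" "?S (proj ?K y) = proj ?K (?S y)" using t by auto
qed

section \<open>Holomorphy of local resolvents\<close>

text \<open>Riesz representation gives a \<open>g\<close> in the closure of the range such that
  \<open>v - g\<close> is orthogonal to the range. Then \<open>v - g\<close> lies in the kernel of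
  \<open>A - w\<close>, hence is \<open>0\<close>.\<close>

lemma shift_range_dense:
  assumes inj: "\<And>y. y \<in> D \<Longrightarrow> shift w y = 0 \<Longrightarrow> y = 0" and "e > 0"
  obtains y where "y \<in> D" and "cnorm (v - shift (cnj w) y) < e"
proof -
  obtain g Y where g: "\<And>y. y \<in> D \<Longrightarrow> cinner (shift (cnj w) y) g = cinner (shift (cnj w) y) v"
    and Y: "\<And>k. Y k \<in> D" "converges_to (\<lambda>k. shift (cnj w) (Y k)) g"
  proof (rule riesz_range[OF subspace, of "shift (cnj w)" "\<lambda>y. cinner (shift (cnj w) y) v" "cnorm v"])
    show "cmod (cinner (shift (cnj w) y) v) \<le> cnorm v * cnorm (shift (cnj w) y)" for y
      using cauchy_schwarz[of "shift (cnj w) y" v] by (simp add: mult.commute)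
  next
    fix g Y
    assume "\<And>y. y \<in> D \<Longrightarrow> cinner (shift (cnj w) y) g = cinner (shift (cnj w) y) v"
      "\<And>k. Y k \<in> D" "converges_to (\<lambda>k. shift (cnj w) (Y k)) g"
    then show thesis by (rule that)
  qed (simp_all add: shift_add shift_scale cinner_simps)
  have "cinner (shift (cnj w) y) (v - g) = cinner y 0" if "y \<in> D" for y
    using g[OF that] by (simp add: cinner_diff_right)
  from shift_maximal[OF this] have "v = g" using inj[of "v - g"] by simp
  then have "(\<lambda>k. cnorm (shift (cnj w) (Y k) - v)) \<longlonglongrightarrow> 0" using Y(2) by (simp add: converges_to_def)
  from LIMSEQ_D[OF this \<open>e > 0\<close>] obtain k where "cnorm (shift (cnj w) (Y k) - v) < e" by auto
  then show thesis using that[OF Y(1)[of k]] cnorm_minus_commute[of v "shift (cnj w) (Y k)"] by simp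
qed

text \<open>The local resolvent \<open>g\<close> of \<open>l\<close> is weakly holomorphic off the real axis and weakly continuous
  across it, hence weakly holomorphic; its Taylor coefficients at the centre form a chain.\<close>

lemma local_resolvent_chain:
  fixes x0 \<rho> M :: real
  defines "B \<equiv> ball (complex_of_real x0) \<rho>"
  assumes \<rho>: "\<rho> > 0" and M: "M \<ge> 0"
    and inj: "\<And>z y. z \<in> B \<Longrightarrow> y \<in> D \<Longrightarrow> shift z y = 0 \<Longrightarrow> y = 0"
    and gl: "\<And>z y. z \<in> B \<Longrightarrow> y \<in> D \<Longrightarrow> cinner (shift (cnj z) y) (g z) = l y"
    and gM: "\<And>z. z \<in> B \<Longrightarrow> cnorm (g z) \<le> M"
  shows "g (complex_of_real x0) \<in> spec_sub x0 (2 / \<rho>)"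
proof -
  have x0B: "complex_of_real x0 \<in> B" using \<rho> by (simp add: B_def)
  have openB: "open B" by (simp add: B_def)
  \<comment> \<open>With \<open>g z\<close> in the linear slot, \<open>\<Phi> v\<close> is
    holomorphic in \<open>z\<close>, while the dependence on \<open>v\<close> is conjugate-linear;
    hence the conjugates in \<open>a_scale\<close> and in the Riesz step.\<close>
  define \<Phi> where "\<Phi> v z = cinner (g z) v" for v z
  have \<Phi>_bound: "cmod (\<Phi> v z) \<le> M * cnorm v" if "z \<in> B" for v z
  proof -
    have "cmod (\<Phi> v z) \<le> cnorm (g z) * cnorm v" unfolding \<Phi>_def by (rule cauchy_schwarz)
    also have "\<dots> \<le> M * cnorm v" using gM[OF that] by (intro mult_right_mono) auto
    finally show ?thesis .
  qed
  \<comment> \<open>Weak form of the identity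
    \<open>(A - w) (g z - g w) = (z - w) g z\<close>.\<close>
  have resolvent: "\<Phi> (shift (cnj w) y) z = \<Phi> (shift (cnj w) y) w + (z - w) * \<Phi> y z"
    if "z \<in> B" "w \<in> B" "y \<in> D" for z w y
  proof -
    have "cinner (shift (cnj w) y) (g z) = cinner (shift (cnj z) y) (g z) + (cnj z - cnj w) * cinner y (g z)"
      by (simp add: shift_change[of "cnj w" y "cnj z"] cinner_simps)
    also have "\<dots> = cinner (shift (cnj w) y) (g w) + (cnj z - cnj w) * cinner y (g z)"
      using gl that by simp
    finally have eq: "cinner (shift (cnj w) y) (g z)
      = cinner (shift (cnj w) y) (g w) + (cnj z - cnj w) * cinner y (g z)" .
    show ?thesis
      using arg_cong[OF eq, of cnj] unfolding \<Phi>_def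
      by (simp add: cinner_cnj[of "g z"] cinner_cnj[of "g w"])
  qed
  \<comment> \<open>For \<open>v\<close> in the range of \<open>A - cnj w\<close> continuity at
    \<open>w\<close> is read off from the resolvent identity; density of that range and the uniform
    bound \<open>M\<close> on \<open>g\<close> give it for every \<open>v\<close>.\<close>
  have cont: "continuous_on B (\<Phi> v)" for v
    unfolding continuous_on_iff
  proof (intro ballI allI impI)
    fix w and e :: real assume w: "w \<in> B" and e: "e > 0"
    define M' where "M' = M + 1"
    have M': "M \<le> M'" "M' > 0" using M by (auto simp: M'_def)
    define e' where "e' = e / (4 * M')"
    have e': "e' > 0" using e M' by (simp add: e'_def)
    obtain y where y: "y \<in> D" "cnorm (v - shift (cnj w) y) < e'"
      using shift_range_dense[OF inj[OF w] e'] by blast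
    define N where "N = M * cnorm y + 1"
    have N: "M * cnorm y < N" "N > 0" using M by (auto simp: N_def add_nonneg_pos)
    define d where "d = e / (2 * N)"
    have d: "d > 0" using e N by (simp add: d_def)
    have "dist (\<Phi> v z) (\<Phi> v w) < e" if z: "z \<in> B" "dist z w < d" for z
    proof -
      define r where "r = v - shift (cnj w) y"
      have "\<Phi> v z - \<Phi> v w = \<Phi> r z - \<Phi> r w + (\<Phi> (shift (cnj w) y) z - \<Phi> (shift (cnj w) y) w)"
        by (simp add: \<Phi>_def r_def cinner_diff_right)
      also have "\<dots> = \<Phi> r z - \<Phi> r w + (z - w) * \<Phi> y z" using resolvent[OF z(1) w y(1)] by simp
      finally have "cmod (\<Phi> v z - \<Phi> v w) \<le> cmod (\<Phi> r z) + cmod (\<Phi> r w) + cmod (z - w) * cmod (\<Phi> y z)"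
        by (metis norm_mult norm_triangle_le norm_triangle_ineq4 add_right_mono)
      moreover have r: "cmod (\<Phi> r u) \<le> e / 4" if "u \<in> B" for u
      proof -
        have "cmod (\<Phi> r u) \<le> M * cnorm r" by (rule \<Phi>_bound[OF that])
        also have "\<dots> \<le> M' * e'" using M' y(2) by (intro mult_mono) (auto simp: r_def)
        also have "\<dots> = e / 4" using M' by (simp add: e'_def)
        finally show ?thesis .
      qed
      moreover have "cmod (z - w) * cmod (\<Phi> y z) < e / 2"
      proof -
        have "cmod (z - w) * cmod (\<Phi> y z) \<le> d * (M * cnorm y)"
          using z(2) d \<Phi>_bound[OF z(1), of y] by (intro mult_mono) (auto simp: dist_norm)
        also have "\<dots> < d * N" using d N by simp
        also have "\<dots> = e / 2" using N by (simp add: d_def)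
        finally show ?thesis .
      qed
      ultimately show ?thesis using r[OF z(1)] r[OF w] unfolding dist_norm by linarith
    qed
    then show "\<exists>d>0. \<forall>z\<in>B. dist z w < d \<longrightarrow> dist (\<Phi> v z) (\<Phi> v w) < e" using d by blast
  qed
  \<comment> \<open>At a nonreal \<open>w\<close> every \<open>v\<close> is of the form
    \<open>(A - cnj w) y\<close>, so the difference quotient of \<open>\<Phi> v\<close> at
    \<open>w\<close> equals \<open>\<Phi> y z\<close>, which converges by continuity.\<close>
  have diff: "\<Phi> v field_differentiable (at w)" if w: "w \<in> B" "Im w \<noteq> 0" for v w
  proof -
    have "bounded_below (cnj w)" using w(2) by (intro bounded_below_nonreal) simp
    then obtain y where y: "y \<in> D" "shift (cnj w) y = v" using bounded_below_surj by blast
    have "(\<Phi> y \<longlongrightarrow> \<Phi> y w) (at w)"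
      using cont[of y] w(1) openB by (simp add: continuous_on_eq_continuous_at isCont_def)
    then have "((\<lambda>z. (\<Phi> v z - \<Phi> v w) / (z - w)) \<longlongrightarrow> \<Phi> y w) (at w)"
    proof (rule Lim_transform_within_open[OF _ openB w(1)])
      show "\<Phi> y z = (\<Phi> v z - \<Phi> v w) / (z - w)" if "z \<in> B" "z \<noteq> w" for z
        using resolvent[OF that(1) w(1) y(1)] that(2) by (simp add: y(2))
    qed
    then show ?thesis unfolding field_differentiable_def has_field_derivative_iff by blast
  qed
  \<comment> \<open>The separating line is the real axis: the real inner product of
    \<open>\<i>\<close> and \<open>z\<close> is \<open>Im z\<close>.\<close>
  have holo: "\<Phi> v holomorphic_on B" for v
  proof (rule holomorphic_on_paste_across_line[OF openB _ _ _ cont, of \<i> v 0])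
    have "\<Phi> v holomorphic_on (B \<inter> {z. Im z \<noteq> 0})"
      unfolding holomorphic_on_def using diff field_differentiable_at_within by blast
    then show "\<Phi> v holomorphic_on B \<inter> {z. \<i> \<bullet> z < 0}" "\<Phi> v holomorphic_on B \<inter> {z. 0 < \<i> \<bullet> z}"
      by (auto elim!: holomorphic_on_subset simp: inner_complex_def)
  qed simp
  define a where "a n v = (deriv ^^ n) (\<Phi> v) (complex_of_real x0) / fact n" for n v
  have a_add: "a n (v + w) = a n v + a n w" for n v w
  proof -
    have "\<Phi> (v + w) = (\<lambda>z. \<Phi> v z + \<Phi> w z)" by (simp add: \<Phi>_def cinner_add_right fun_eq_iff)
    then show ?thesis
      by (simp add: a_def higher_deriv_add[OF holo holo openB x0B] add_divide_distrib)
  qed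
  have a_scale: "a n (c *\<^sub>C v) = cnj c * a n v" for n c v
  proof -
    have "\<Phi> (c *\<^sub>C v) = (\<lambda>z. cnj c * \<Phi> v z)" by (simp add: \<Phi>_def cinner_scaleC_right fun_eq_iff)
    then show ?thesis by (simp add: a_def higher_deriv_cmult[OF holo x0B openB])
  qed
  \<comment> \<open>Cauchy's estimate on the circle of radius \<open>\<rho> / 2\<close>, whose
    closed disc lies in \<open>B\<close>; this is the origin of the rate
    \<open>2 / \<rho>\<close>.\<close>
  have a_bound: "cmod (a n v) \<le> M * (2 / \<rho>) ^ n * cnorm v" for n v
  proof -
    have sub: "cball (complex_of_real x0) (\<rho> / 2) \<subseteq> B" using \<rho> by (auto simp: B_def)
    have "cmod ((deriv ^^ n) (\<Phi> v) (complex_of_real x0)) \<le> fact n * (M * cnorm v) / (\<rho> / 2) ^ n"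
    proof (rule Cauchy_inequality)
      show "\<Phi> v holomorphic_on ball (complex_of_real x0) (\<rho> / 2)"
        using holomorphic_on_subset[OF holo] sub ball_subset_cball by blast
      show "continuous_on (cball (complex_of_real x0) (\<rho> / 2)) (\<Phi> v)"
        using continuous_on_subset[OF cont sub] .
      show "cmod (\<Phi> v z) \<le> M * cnorm v" if "cmod (complex_of_real x0 - z) = \<rho> / 2" for z
        using that sub by (intro \<Phi>_bound) (auto simp: dist_norm)
    qed (use \<rho> in simp)
    then have "cmod (a n v) \<le> M * cnorm v / (\<rho> / 2) ^ n"
      by (simp add: a_def norm_divide divide_le_eq mult_ac)
    then show ?thesis using \<rho> by (simp add: power_divide field_simps)
  qed
  \<comment> \<open>Comparison of the Taylor coefficients of order \<open>Suc n\<close> in the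
    resolvent identity with \<open>w\<close> the centre.\<close>
  have a_Suc: "a (Suc n) (shift (complex_of_real x0) y) = a n y" if y: "y \<in> D" for n y
  proof -
    let ?x = "complex_of_real x0"
    let ?c = "\<Phi> (shift ?x y) ?x"
    have "(deriv ^^ Suc n) (\<Phi> (shift ?x y)) ?x = (deriv ^^ Suc n) (\<lambda>z. ?c + (z - ?x) * \<Phi> y z) ?x"
    proof (rule higher_deriv_transform_within_open[OF holo _ openB x0B])
      show "(\<lambda>z. ?c + (z - ?x) * \<Phi> y z) holomorphic_on B" by (intro holomorphic_intros holo)
      show "\<Phi> (shift ?x y) z = ?c + (z - ?x) * \<Phi> y z" if "z \<in> B" for z
        using resolvent[OF that x0B y] by simp
    qed
    also have "\<dots> = (deriv ^^ Suc n) (\<lambda>z. ?c) ?x + (deriv ^^ Suc n) (\<lambda>z. (z - ?x) * \<Phi> y z) ?x"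
      by (rule higher_deriv_add[OF _ _ openB x0B]) (intro holomorphic_intros holo)+
    also have "\<dots> = of_nat (Suc n) * (deriv ^^ n) (\<Phi> y) ?x"
      using higher_deriv_linear_mult[OF holo openB x0B, of n y] by (simp del: funpow.simps of_nat_Suc)
    finally show ?thesis unfolding a_def by (simp del: funpow.simps of_nat_Suc)
  qed
  \<comment> \<open>The conjugate of \<open>a n\<close> is linear and bounded, so Riesz
    representation with \<open>T\<close> the identity turns the coefficient into a vector.\<close>
  have "\<exists>h. cnorm h \<le> M * (2 / \<rho>) ^ n \<and> (\<forall>v. cinner v h = cnj (a n v))" for n
  proof -
    obtain h Y where "\<And>v. v \<in> UNIV \<Longrightarrow> cinner v h = cnj (a n v)" "cnorm h \<le> M * (2 / \<rho>) ^ n"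
      "\<And>k::nat. Y k \<in> (UNIV :: 'a set)" "converges_to Y h"
    proof (rule riesz_range[of UNIV "\<lambda>v. v" "\<lambda>v. cnj (a n v)" "M * (2 / \<rho>) ^ n"])
      fix h Y
      assume "\<And>v. v \<in> UNIV \<Longrightarrow> cinner v h = cnj (a n v)" "cnorm h \<le> M * (2 / \<rho>) ^ n"
        "\<And>k. Y k \<in> (UNIV :: 'a set)" "converges_to Y h"
      then show thesis by (rule that)
    qed (use a_bound M \<rho> in \<open>simp_all add: csubspace_def a_add a_scale\<close>)
    then show ?thesis by blast
  qed
  then obtain h where h_bound: "\<And>n. cnorm (h n) \<le> M * (2 / \<rho>) ^ n"
    and h: "\<And>n v. cinner v (h n) = cnj (a n v)" by metis
  have "h (Suc n) \<in> D \<and> shift (complex_of_real x0) (h (Suc n)) = h n" for n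
  proof -
    have "cinner (shift (cnj (complex_of_real x0)) y) (h (Suc n)) = cinner y (h n)" if "y \<in> D" for y
      using a_Suc[OF that] by (simp add: h)
    from shift_maximal[OF this] show ?thesis by blast
  qed
  then have "chain x0 (2 / \<rho>) M h" using h_bound by (simp add: chain_def)
  moreover have "h 0 = g (complex_of_real x0)"
  proof -
    have "cinner v (h 0 - g (complex_of_real x0)) = 0" for v
      using cinner_cnj[of v "g (complex_of_real x0)"]
      by (simp add: cinner_diff_right h a_def \<Phi>_def)
    then show ?thesis using cinner_eq_zero_iff[of "h 0 - g (complex_of_real x0)"] by simp
  qed
  ultimately show ?thesis unfolding spec_sub_def by blast
qed

section \<open>Reducing subspaces from local bounds\<close>

text \<open>\<open>L\<close> is the orthogonal complement of the spectral subspace \<open>K\<close>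
  with rate \<open>2 / \<rho>\<close>. For \<open>y\<close> in \<open>L\<close> the vector
  \<open>(A - x0) y\<close> stays orthogonal to \<open>K\<close>, whereas \<open>l y\<close> is its
  inner product with \<open>g x0\<close>, an element of \<open>K\<close>. If \<open>L\<close> were
  trivial, \<open>K\<close> would be the whole space and \<open>A - x0\<close> bounded
  below.\<close>

lemma exists_reducing_subspace:
  fixes x0 \<rho> :: real and \<Lambda> :: "('a \<Rightarrow> complex) set"
  assumes \<rho>: "\<rho> > 0"
    and linear: "\<And>l x y. l \<in> \<Lambda> \<Longrightarrow> x \<in> D \<Longrightarrow> y \<in> D \<Longrightarrow> l (x + y) = l x + l y"
      "\<And>l c x. l \<in> \<Lambda> \<Longrightarrow> x \<in> D \<Longrightarrow> l (c *\<^sub>C x) = c * l x"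
    and inj: "\<And>z y. z \<in> ball (complex_of_real x0) \<rho> \<Longrightarrow> y \<in> D \<Longrightarrow> shift z y = 0 \<Longrightarrow> y = 0"
    and bound: "\<And>l. l \<in> \<Lambda> \<Longrightarrow> \<exists>M\<ge>0. \<forall>z\<in>ball (complex_of_real x0) \<rho>. \<forall>y\<in>D.
      cmod (l y) \<le> M * cnorm (shift (cnj z) y)"
    and spec: "complex_of_real x0 \<in> spectrum_op (D, A)"
  obtains L where "csubspace L" "cclosed L" "L \<noteq> {0}"
    "\<And>y. y \<in> D \<Longrightarrow> proj L y \<in> D \<and> A (proj L y) = proj L (A y)"
    "\<And>l y. l \<in> \<Lambda> \<Longrightarrow> y \<in> D \<Longrightarrow> y \<in> L \<Longrightarrow> l y = 0"
proof -
  define R where "R = 2 / \<rho>"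
  have R: "R > 0" using \<rho> by (simp add: R_def)
  define K where "K = spec_sub x0 R"
  define L where "L = ortho_compl K"
  let ?S = "shift (complex_of_real x0)"
  note Ksub = csubspace_spec_sub[of x0 R, folded K_def] cclosed_spec_sub[OF R, of x0, folded K_def]
  note projK = proj_spec_sub[OF _ R, of _ x0, folded K_def]
  have x0: "complex_of_real x0 \<in> ball (complex_of_real x0) \<rho>" using \<rho> by simp
  have projL: "proj L y = y - proj K y" for y unfolding L_def by (rule proj_ortho_compl[OF Ksub])
  have "L \<noteq> {0}"
  proof
    assume L: "L = {0}"
    have "f \<in> K" for f
    proof -
      have "proj L f \<in> L" unfolding L_def by (rule proj_in[OF csubspace_ortho_compl cclosed_ortho_compl])
      then have "f = proj K f" using L projL[of f] by simp
      then show ?thesis using proj_in[OF Ksub] by metis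
    qed
    have "bounded_below (complex_of_real x0)"
    proof (rule bounded_belowI)
      fix y assume y: "y \<in> D"
      obtain t where t: "t \<in> D" "?S t = ?S y" "cnorm t \<le> R * cnorm (?S y)"
        using spec_sub_solve[of "?S y" x0 R] \<open>\<And>f. f \<in> K\<close> R unfolding K_def by metis
      have "t - y = 0" using inj[OF x0 D_diff[OF t(1) y]] t y by (simp add: shift_diff)
      then show "cnorm y \<le> R * cnorm (?S y)" using t(3) by simp
    qed
    then show False using spec by (simp add: spectrum_iff)
  qed
  moreover have "proj L y \<in> D \<and> A (proj L y) = proj L (A y)" if y: "y \<in> D" for y
  proof -
    have "A (proj K y) = proj K (A y)"
      using projK(2)[OF y] by (simp add: shift_def proj_diff[OF Ksub] proj_scaleC[OF Ksub])
    then show ?thesis unfolding projL using y projK(1)[OF y] by (simp add: D_diff diff)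
  qed
  moreover have "l y = 0" if l: "l \<in> \<Lambda>" and y: "y \<in> D" "y \<in> L" for l y
  proof -
    obtain M where M: "M \<ge> 0"
      "\<And>z y. z \<in> ball (complex_of_real x0) \<rho> \<Longrightarrow> y \<in> D \<Longrightarrow> cmod (l y) \<le> M * cnorm (shift (cnj z) y)"
      using bound[OF l] by blast
    have "\<exists>g. cnorm g \<le> M \<and> (\<forall>y\<in>D. cinner (shift (cnj z) y) g = l y)"
      if z: "z \<in> ball (complex_of_real x0) \<rho>" for z
    proof -
      obtain g Y where "\<And>y. y \<in> D \<Longrightarrow> cinner (shift (cnj z) y) g = l y" "cnorm g \<le> M"
        "\<And>k::nat. Y k \<in> D" "converges_to (\<lambda>k. shift (cnj z) (Y k)) g"
      proof (rule riesz_range[OF subspace, of "shift (cnj z)" l M])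
        fix g Y assume "\<And>y. y \<in> D \<Longrightarrow> cinner (shift (cnj z) y) g = l y" "cnorm g \<le> M"
          "\<And>k::nat. Y k \<in> D" "converges_to (\<lambda>k. shift (cnj z) (Y k)) g"
        then show thesis by (rule that)
      qed (use linear[OF l] M z in \<open>simp_all add: shift_add shift_scale\<close>)
      then show ?thesis by blast
    qed
    then obtain g where g: "\<And>z. z \<in> ball (complex_of_real x0) \<rho> \<Longrightarrow> cnorm (g z) \<le> M"
      "\<And>z y. z \<in> ball (complex_of_real x0) \<rho> \<Longrightarrow> y \<in> D \<Longrightarrow> cinner (shift (cnj z) y) (g z) = l y"
      by metis
    have gK: "g (complex_of_real x0) \<in> K"
      unfolding K_def R_def by (rule local_resolvent_chain[OF \<rho> M(1) inj g(2) g(1)])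
    have "proj K y = 0"
      using y(2) Ksub(1) by (intro proj_unique[OF Ksub]) (auto simp: L_def ortho_compl_def csubspace_def)
    then have "proj K (?S y) = 0" using projK(2)[OF y(1)] by (simp add: shift_zero)
    then have "cinner (?S y) (g (complex_of_real x0)) = 0" using proj_orth[OF Ksub gK, of "?S y"] by simp
    then show ?thesis using g(2)[OF x0 y(1)] by simp
  qed
  ultimately show thesis
    using that[of L] csubspace_ortho_compl cclosed_ortho_compl unfolding L_def by blast
qed

section \<open>Dependence on the spectral parameter\<close>

lemma continuous_on_cnorm_shift: "continuous_on UNIV (\<lambda>z. cnorm (shift z y))"
  unfolding continuous_on_iff
proof (intro ballI allI impI)
  fix w :: complex and e :: real assume e: "e > 0"
  have "dist (cnorm (shift z y)) (cnorm (shift w y)) < e" if z: "dist z w < e / (cnorm y + 1)" for z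
  proof -
    have pos: "cnorm y + 1 > 0" by (simp add: add_nonneg_pos)
    have "dist (cnorm (shift z y)) (cnorm (shift w y)) \<le> dist z w * cnorm y"
      using cnorm_shift_le[of z y w] cnorm_shift_le[of w y z]
      by (simp add: dist_norm norm_minus_commute abs_le_iff)
    also have "\<dots> \<le> dist z w * (cnorm y + 1)" by (intro mult_left_mono) auto
    also have "\<dots> < e" using z pos by (simp add: less_divide_eq)
    finally show ?thesis .
  qed
  moreover have "e / (cnorm y + 1) > 0" using e by (simp add: add_nonneg_pos)
  ultimately show "\<exists>d>0. \<forall>z\<in>UNIV. dist z w < d \<longrightarrow> dist (cnorm (shift z y)) (cnorm (shift w y)) < e"
    by blast
qed

text \<open>Let \<open>s\<close> be a spectral point nearest to \<open>x = Re z\<close>, at distance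
  \<open>m\<close>. Replacing \<open>s\<close> by \<open>x\<close> costs at most
  \<open>m * cnorm y\<close>, which \<open>nearest_spectrum\<close> bounds by the norm of
  \<open>(A - x) y\<close>; hence the factor \<open>2\<close>. Passing from \<open>x\<close> to
  \<open>z\<close> only increases the norm.\<close>

lemma spectrum_bound_spreads:
  assumes spec: "complex_of_real x0 \<in> spectrum_op (D, A)" and "k \<ge> 0"
    and bound: "\<And>s y. s \<in> spectrum_op (D, A) \<Longrightarrow> s \<in> ball (complex_of_real x0) e \<Longrightarrow> y \<in> D \<Longrightarrow>
      q y \<le> k * cnorm (shift s y)"
    and z: "z \<in> ball (complex_of_real x0) (e / 2)" and y: "y \<in> D"
  shows "q y \<le> 2 * k * cnorm (shift z y)"
proof -
  define x where "x = Re z"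
  have "\<bar>x - x0\<bar> \<le> cmod (z - complex_of_real x0)"
    using abs_Re_le_cmod[of "z - complex_of_real x0"] by (simp add: x_def)
  then have x: "\<bar>x - x0\<bar> < e / 2" using z by (simp add: dist_norm norm_minus_commute)
  have "\<exists>y0\<in>D. y0 \<noteq> 0"
  proof (rule ccontr)
    assume "\<not> (\<exists>y0\<in>D. y0 \<noteq> 0)"
    then have "bounded_below (complex_of_real x0)" by (intro bounded_belowI[of 0]) auto
    then show False using spec by (simp add: spectrum_iff)
  qed
  then obtain m s where ms: "complex_of_real s \<in> spectrum_op (D, A)" "\<bar>s - x\<bar> = m"
    and m: "\<And>y. y \<in> D \<Longrightarrow> m * cnorm y \<le> cnorm (shift (complex_of_real x) y)"
    using nearest_spectrum by metis
  \<comment> \<open>\<open>x0\<close> is itself in the spectrum, so the nearest spectral point is no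
    farther away. With \<open>z\<close> in the disc of half the radius, \<open>s\<close> stays in
    the disc where the bound is given.\<close>
  have "m \<le> \<bar>x - x0\<bar>"
  proof (rule ccontr)
    assume neg: "\<not> m \<le> \<bar>x - x0\<bar>"
    have "bounded_below (complex_of_real x0)"
    proof (rule bounded_belowI)
      fix y assume "y \<in> D"
      then have "m * cnorm y \<le> cnorm (shift (complex_of_real x0) y) + \<bar>x - x0\<bar> * cnorm y"
        using m[of y] cnorm_shift_le[of "complex_of_real x" y "complex_of_real x0"]
        by (simp add: abs_minus_commute flip: of_real_diff)
      then have "(m - \<bar>x - x0\<bar>) * cnorm y \<le> cnorm (shift (complex_of_real x0) y)"
        by (simp add: left_diff_distrib)
      then show "cnorm y \<le> (1 / (m - \<bar>x - x0\<bar>)) * cnorm (shift (complex_of_real x0) y)"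
        using neg by (simp add: field_simps)
    qed
    then show False using spec by (simp add: spectrum_iff)
  qed
  then have "\<bar>s - x0\<bar> < e" using x ms(2) by linarith
  then have "complex_of_real s \<in> ball (complex_of_real x0) e"
    by (simp add: dist_norm abs_minus_commute flip: of_real_diff)
  then have "q y \<le> k * cnorm (shift (complex_of_real s) y)" by (rule bound[OF ms(1) _ y])
  also have "\<dots> \<le> k * (2 * cnorm (shift z y))"
  proof (rule mult_left_mono[OF _ \<open>k \<ge> 0\<close>])
    have "cnorm (shift (complex_of_real s) y) \<le> cnorm (shift (complex_of_real x) y) + m * cnorm y"
      using cnorm_shift_le[of "complex_of_real s" y "complex_of_real x"] ms(2)
      by (simp add: abs_minus_commute flip: of_real_diff)
    then show "cnorm (shift (complex_of_real s) y) \<le> 2 * cnorm (shift z y)"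
      using m[OF y] cnorm_shift_Re_le[OF y, of z] by (simp add: x_def)
  qed
  finally show ?thesis by simp
qed

end

section \<open>Finite-dimensional linear algebra\<close>

lemma vinner_axis_right [simp]: "vinner u (axis i 1) = u $ i"
  by (simp add: vinner_def axis_def if_distrib[of cnj] if_distrib[of "(*) _"] cong: if_cong)

lemma vinner_axis_left [simp]: "vinner (axis i 1) v = cnj (v $ i)"
  by (simp add: vinner_def axis_def if_distrib[of "\<lambda>c. c * _"] cong: if_cong)

lemma vinner_zero_left [simp]: "vinner 0 v = 0"
  and vinner_zero_right [simp]: "vinner u 0 = 0"
  by (simp_all add: vinner_def)

lemma vinner_nondegenerate_right: "(\<And>u. vinner u v = 0) \<Longrightarrow> v = 0"
  by (metis complex_cnj_zero_iff vec_eq_iff vinner_axis_left zero_index)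

lemma additive_sum:
  fixes G :: "'a::complex_hilbert \<Rightarrow> complex ^ 'n"
  assumes V: "csubspace V"
    and lin: "\<And>x y a b. x \<in> V \<Longrightarrow> y \<in> V \<Longrightarrow> G (a *\<^sub>C x + b *\<^sub>C y) = a *s G x + b *s G y"
    and e: "\<And>i. i \<in> I \<Longrightarrow> e i \<in> V"
  shows "G (\<Sum>i\<in>I. c i *\<^sub>C e i) = (\<Sum>i\<in>I. c i *s G (e i))"
proof -
  have V0: "0 \<in> V" using V by (simp add: csubspace_def)
  have G0: "G 0 = 0" using lin[OF V0 V0, of 0 0] by simp
  show ?thesis using e
  proof (induction I rule: infinite_finite_induct)
    case (insert i I)
    have "(\<Sum>i\<in>I. c i *\<^sub>C e i) \<in> V"
      using insert V by (intro csubspace_sum) (auto simp: csubspace_def)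
    then show ?case using lin[of "e i" "\<Sum>i\<in>I. c i *\<^sub>C e i" "c i" 1] insert by (simp add: scaleC_one)
  qed (simp_all add: G0)
qed

text \<open>The matrix of \<open>G\<close> in a basis of \<open>V\<close> is square with trivial
  kernel, so its left inverse is also a right inverse.\<close>

lemma cdim_eq_inj_imp_surj:
  fixes G :: "'a::complex_hilbert \<Rightarrow> complex ^ 'n"
  assumes V: "csubspace V" and dim: "cdim_eq V CARD('n)"
    and lin: "\<And>x y a b. x \<in> V \<Longrightarrow> y \<in> V \<Longrightarrow> G (a *\<^sub>C x + b *\<^sub>C y) = a *s G x + b *s G y"
    and inj: "\<And>x. x \<in> V \<Longrightarrow> G x = 0 \<Longrightarrow> x = 0"
  shows "\<exists>x\<in>V. G x = u"
proof -
  obtain e where e: "\<And>i. i < CARD('n) \<Longrightarrow> e i \<in> V"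
    and indep: "\<And>c. (\<Sum>i<CARD('n). c i *\<^sub>C e i) = 0 \<Longrightarrow> (\<forall>i<CARD('n). c i = 0)"
    using dim unfolding cdim_eq_def by blast
  obtain \<beta> :: "'n \<Rightarrow> nat" where \<beta>: "bij_betw \<beta> UNIV {..<CARD('n)}"
    by (metis ex_bij_betw_finite_nat finite_class.finite_UNIV atLeast0LessThan)
  have e': "e (\<beta> i) \<in> V" for i using \<beta> e by (auto simp: bij_betw_def)
  define P :: "complex ^ 'n ^ 'n" where "P = (\<chi> j i. G (e (\<beta> i)) $ j)"
  define comb where "comb c = (\<Sum>i\<in>UNIV. (c $ i) *\<^sub>C e (\<beta> i))" for c :: "complex ^ 'n"
  have comb: "comb c \<in> V" for c
    unfolding comb_def using V e' by (intro csubspace_sum) (auto simp: csubspace_def)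
  have G_comb: "G (comb c) = P *v c" for c
  proof -
    have "G (comb c) = (\<Sum>i\<in>UNIV. (c $ i) *s G (e (\<beta> i)))"
      unfolding comb_def by (rule additive_sum[OF V lin]) (simp_all add: e')
    then show ?thesis by (simp add: vec_eq_iff matrix_vector_mult_def P_def mult.commute)
  qed
  have "c = 0" if "P *v c = 0" for c
  proof -
    have "comb c = 0" using inj[OF comb] that G_comb by simp
    also have "comb c = (\<Sum>k<CARD('n). (c $ inv_into UNIV \<beta> k) *\<^sub>C e k)"
      unfolding comb_def
      by (subst sum.reindex_bij_betw[OF \<beta>, symmetric]) (use \<beta> in \<open>simp add: bij_betw_def\<close>)
    finally have "\<forall>k<CARD('n). c $ inv_into UNIV \<beta> k = 0" by (rule indep)
    then have "c $ i = 0" for i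
      using \<beta> by (metis UNIV_I bij_betw_def bij_betw_inv_into_left image_eqI lessThan_iff)
    then show "c = 0" by (simp add: vec_eq_iff)
  qed
  then obtain Q where "Q ** P = mat 1" using matrix_left_invertible_ker by blast
  then have "P *v (Q *v u) = u"
    by (metis matrix_left_right_inverse matrix_vector_mul_assoc matrix_vector_mul_lid)
  then show ?thesis using comb G_comb by metis
qed

text \<open>\<open>G\<close> is an isomorphism onto the coordinate space, and the preimages of the
  standard basis form a basis of \<open>V\<close>.\<close>

lemma cdim_eq_dual_basis:
  fixes G :: "'a::complex_hilbert \<Rightarrow> complex ^ 'n"
  assumes V: "csubspace V"
    and lin: "\<And>x y a b. x \<in> V \<Longrightarrow> y \<in> V \<Longrightarrow> G (a *\<^sub>C x + b *\<^sub>C y) = a *s G x + b *s G y"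
    and inj: "\<And>x. x \<in> V \<Longrightarrow> G x = 0 \<Longrightarrow> x = 0"
    and e: "\<And>i. e i \<in> V" "\<And>i. G (e i) = axis i 1"
  shows "cdim_eq V CARD('n)"
proof -
  obtain \<gamma> :: "nat \<Rightarrow> 'n" where \<gamma>: "bij_betw \<gamma> {..<CARD('n)} UNIV"
    by (metis ex_bij_betw_nat_finite finite_class.finite_UNIV atLeast0LessThan)
  have G_comb: "G (\<Sum>i\<in>UNIV. c i *\<^sub>C e i) = (\<chi> i. c i)" for c
  proof -
    have "G (\<Sum>i\<in>UNIV. c i *\<^sub>C e i) = (\<Sum>i\<in>UNIV. c i *s G (e i))"
      by (rule additive_sum[OF V lin]) (simp_all add: e(1))
    then show ?thesis by (simp add: vec_eq_iff e(2) axis_def if_distrib[of "(*) _"] cong: if_cong)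
  qed
  have comb: "(\<Sum>i\<in>UNIV. c i *\<^sub>C e i) \<in> V" for c
    using V e(1) by (intro csubspace_sum) (auto simp: csubspace_def)
  have reindex: "(\<Sum>k<CARD('n). c (\<gamma> k) *\<^sub>C e (\<gamma> k)) = (\<Sum>i\<in>UNIV. c i *\<^sub>C e i)" for c
    by (rule sum.reindex_bij_betw[OF \<gamma>])
  show ?thesis
    unfolding cdim_eq_def
  proof (intro exI[of _ "\<lambda>k. e (\<gamma> k)"] conjI allI impI ballI)
    show "e (\<gamma> k) \<in> V" for k by (rule e(1))
  next
    fix c :: "nat \<Rightarrow> complex" and k
    assume sum0: "(\<Sum>k<CARD('n). c k *\<^sub>C e (\<gamma> k)) = 0" and k: "k < CARD('n)"
    define c' where "c' i = c (inv_into {..<CARD('n)} \<gamma> i)" for i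
    have c': "c' (\<gamma> k) = c k" if "k < CARD('n)" for k
      using that \<gamma> by (simp add: c'_def bij_betw_def)
    have "(\<Sum>i\<in>UNIV. c' i *\<^sub>C e i) = 0"
      using sum0 unfolding reindex[symmetric] by (simp add: c')
    then have "(\<chi> i. c' i) = G 0" using G_comb[of c'] by simp
    also have "\<dots> = (\<chi> i. 0)" using G_comb[of "\<lambda>i. 0"] by simp
    finally have "(\<chi> i. c' i) = (\<chi> i. 0)" .
    from arg_cong[OF this, of "\<lambda>v. v $ \<gamma> k"] have "c' (\<gamma> k) = 0" by simp
    then show "c k = 0" using c'[OF k] by simp
  next
    fix x assume x: "x \<in> V"
    let ?s = "\<Sum>i\<in>UNIV. (G x $ i) *\<^sub>C e i"
    have "G (x - ?s) = G x - G ?s"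
      using lin[OF x comb, of 1 "- 1"] by (simp add: scaleC_one scaleC_minus_one)
    then have "G (x - ?s) = 0" by (simp add: G_comb)
    then have "x = ?s" using inj[OF csubspace_diff[OF V x comb]] by simp
    then show "\<exists>c. x = (\<Sum>k<CARD('n). c k *\<^sub>C e (\<gamma> k))"
      unfolding reindex[of "\<lambda>i. G x $ i", symmetric]
      by (rule exI[where x = "\<lambda>k. G x $ \<gamma> k"])
  qed
qed

section \<open>Boundary triplets\<close>

lemma dense_imp_orthogonal_zero:
  assumes "dense_in S UNIV" and "\<And>x. x \<in> S \<Longrightarrow> cinner x v = 0"
  shows "v = 0"
proof (rule ccontr)
  assume "v \<noteq> 0"
  then have v: "cnorm v > 0" by (simp add: less_le)
  then obtain x where x: "x \<in> S" "cnorm (v - x) < cnorm v"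
    using assms(1) unfolding dense_in_def by blast
  have "cinner (v - x) v = complex_of_real ((cnorm v)\<^sup>2)"
    using assms(2)[OF x(1)] by (simp add: cinner_diff_left cinner_self)
  then have "(cnorm v)\<^sup>2 \<le> cnorm (v - x) * cnorm v"
    using cauchy_schwarz[of "v - x" v] by (simp add: norm_power)
  then show False using x(2) v by (simp add: power2_eq_square)
qed

lemma linear_op_add:
  assumes "linear_op T" "x \<in> dom T" "y \<in> dom T"
  shows "app T (x + y) = app T x + app T y"
proof -
  have "app T (1 *\<^sub>C x + 1 *\<^sub>C y) = 1 *\<^sub>C app T x + 1 *\<^sub>C app T y"
    using assms unfolding linear_op_def by blast
  then show ?thesis by (simp add: scaleC_one)
qed

lemma linear_op_scale:
  assumes "linear_op T" "x \<in> dom T"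
  shows "app T (c *\<^sub>C x) = c *\<^sub>C app T x"
proof -
  have "app T (c *\<^sub>C x + 0 *\<^sub>C x) = c *\<^sub>C app T x + 0 *\<^sub>C app T x"
    using assms unfolding linear_op_def by blast
  then show ?thesis by simp
qed

text \<open>\<open>B + i\<close> is bounded below, so on a closed symmetric operator its range is closed.\<close>

lemma symmetric_closed_range:
  assumes B: "symmetric_op B" "closed_op B"
  shows "\<exists>b\<in>dom B. \<forall>y\<in>dom B.
    cinner (app B y + \<i> *\<^sub>C y) (w - (app B b + \<i> *\<^sub>C b)) = 0"
proof -
  have lin: "linear_op B" using B(1) by (simp add: symmetric_op_def)
  then have sub: "csubspace (dom B)" by (simp add: linear_op_def)
  have sym: "cinner (app B x) y = cinner x (app B y)" if "x \<in> dom B" "y \<in> dom B" for x y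
    using B(1) that by (simp add: symmetric_op_def)
  define T where "T y = app B y + \<i> *\<^sub>C y" for y
  have T_add: "T (x + y) = T x + T y" if "x \<in> dom B" "y \<in> dom B" for x y
    using that by (simp add: T_def linear_op_add[OF lin] scaleC_add_right)
  have T_scale: "T (c *\<^sub>C x) = c *\<^sub>C T x" if "x \<in> dom B" for x c
    using that by (simp add: T_def linear_op_scale[OF lin that] scaleC_add_right scaleC_scaleC mult.commute)
  have T_norm: "cnorm y \<le> cnorm (T y)" if "y \<in> dom B" for y
  proof (rule power2_le_imp_le)
    have "cinner (app B y) y = cnj (cinner (app B y) y)"
      using sym[OF that that] cinner_cnj[of y "app B y"] by simp
    from arg_cong[OF this, of Im] have "Re (cinner (app B y) (\<i> *\<^sub>C y)) = 0"
      by (simp add: cinner_scaleC_right)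
    then show "(cnorm y)\<^sup>2 \<le> (cnorm (T y))\<^sup>2" by (simp add: T_def cnorm_add_sq cnorm_scaleC)
  qed simp
  obtain g Y where g: "\<And>y. y \<in> dom B \<Longrightarrow> cinner (T y) g = cinner (T y) w"
    and Y: "\<And>k. Y k \<in> dom B" "converges_to (\<lambda>k. T (Y k)) g"
  proof (rule riesz_range[OF sub, of T "\<lambda>y. cinner (T y) w" "cnorm w"])
    show "cmod (cinner (T y) w) \<le> cnorm w * cnorm (T y)" for y
      using cauchy_schwarz[of "T y" w] by (simp add: mult.commute)
  next
    fix g Y
    assume "\<And>y. y \<in> dom B \<Longrightarrow> cinner (T y) g = cinner (T y) w"
      "\<And>k. Y k \<in> dom B" "converges_to (\<lambda>k. T (Y k)) g"
    then show thesis by (rule that)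
  qed (simp_all add: T_add T_scale cinner_simps)
  \<comment> \<open>Only the images \<open>T (Y k)\<close> are known to converge; the lower bound
    makes \<open>Y\<close> itself Cauchy, and closedness of \<open>B\<close> then puts its limit in
    the domain.\<close>
  have diff: "cnorm (Y i - Y j) \<le> cnorm (T (Y i) - T (Y j))" for i j
  proof -
    have mem: "Y i - Y j \<in> dom B" by (rule csubspace_diff[OF sub Y(1) Y(1)])
    have "T (Y i) = T (Y i - Y j) + T (Y j)" using T_add[OF mem Y(1)[of j]] by simp
    then show ?thesis using T_norm[OF mem] by simp
  qed
  have "\<exists>b. converges_to Y b"
  proof (rule cauchy_converges)
    fix e :: real assume "e > 0"
    then have "e / 2 > 0" by simp
    from LIMSEQ_D[OF Y(2)[unfolded converges_to_def] this]
    obtain N where N: "\<And>k. k \<ge> N \<Longrightarrow> cnorm (T (Y k) - g) < e / 2" by auto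
    have "cnorm (Y i - Y j) < e" if "i \<ge> N" "j \<ge> N" for i j
      using diff[of i j] cnorm_triangle_diff[of "T (Y i)" "T (Y j)" g] N[OF that(1)] N[OF that(2)]
        cnorm_minus_commute[of g "T (Y j)"] by linarith
    then show "\<exists>N. \<forall>m\<ge>N. \<forall>k\<ge>N. cnorm (Y m - Y k) < e" by blast
  qed
  then obtain b where b: "converges_to Y b" ..
  have "converges_to (\<lambda>k. app B (Y k)) (g - \<i> *\<^sub>C b)"
    unfolding converges_to_def
  proof (rule Lim_null_comparison[OF always_eventually])
    show "(\<lambda>k. cnorm (T (Y k) - g) + cnorm (Y k - b)) \<longlonglongrightarrow> 0"
      using tendsto_add[of "\<lambda>k. cnorm (T (Y k) - g)" 0 _ "\<lambda>k. cnorm (Y k - b)" 0] Y(2) b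
      by (simp add: converges_to_def)
    show "\<forall>k. norm (cnorm (app B (Y k) - (g - \<i> *\<^sub>C b))) \<le> cnorm (T (Y k) - g) + cnorm (Y k - b)"
    proof
      fix k
      have eq: "app B (Y k) - (g - \<i> *\<^sub>C b) = (T (Y k) - g) - \<i> *\<^sub>C (Y k - b)"
        by (simp add: T_def scaleC_diff_right algebra_simps)
      show "norm (cnorm (app B (Y k) - (g - \<i> *\<^sub>C b))) \<le> cnorm (T (Y k) - g) + cnorm (Y k - b)"
        unfolding eq using cnorm_diff_triangle[of "T (Y k) - g" "\<i> *\<^sub>C (Y k - b)"] by (simp add: cnorm_scaleC)
    qed
  qed
  then have "b \<in> dom B \<and> app B b = g - \<i> *\<^sub>C b"
    using B(2) Y(1) b unfolding closed_op_def by blast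
  then have b: "b \<in> dom B" and gb: "app B b + \<i> *\<^sub>C b = g" by auto
  show ?thesis
    by (rule bexI[OF _ b]) (use g in \<open>simp add: gb T_def cinner_diff_right\<close>)
qed

section \<open>The adjoint and the boundary maps\<close>

locale boundary_problem =
  fixes B :: "'a::complex_hilbert op" and G1 G2 :: "'a \<Rightarrow> complex ^ 'n::finite"
  assumes symmetric: "symmetric_op B" and closed: "closed_op B"
    and cns: "completely_non_selfadjoint B"
    and triplet: "boundary_triplet B G1 G2"
begin

abbreviation "Ds \<equiv> dom (adjoint B)"
abbreviation "As \<equiv> app (adjoint B)"

definition D1 :: "'a set" where "D1 = Ds \<inter> {x. G1 x = 0}"

lemma lin_B: "linear_op B"
  and dense_B: "dense_in (dom B) UNIV"
  and sym_B: "x \<in> dom B \<Longrightarrow> y \<in> dom B \<Longrightarrow> cinner (app B x) y = cinner x (app B y)"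
  using symmetric by (simp_all add: symmetric_op_def densely_defined_def)

lemma sub_B: "csubspace (dom B)"
  using lin_B by (simp add: linear_op_def)

text \<open>Density of the domain makes the vector selected by \<open>THE\<close> in
  \<open>adjoint\<close> unique.\<close>

lemma adjointI:
  assumes "\<And>x. x \<in> dom B \<Longrightarrow> cinner (app B x) y = cinner x z"
  shows "y \<in> Ds" and "As y = z"
proof -
  show "y \<in> Ds" using assms by (auto simp: adjoint_def dom_def)
  have uniq: "z' = z" if "\<forall>x\<in>dom B. cinner (app B x) y = cinner x z'" for z'
  proof -
    have "z' - z = 0"
      by (rule dense_imp_orthogonal_zero[OF dense_B]) (use assms that in \<open>simp add: cinner_diff_right\<close>)
    then show ?thesis by simp
  qed
  have "(THE z. \<forall>x\<in>dom B. cinner (app B x) y = cinner x z) = z"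
    by (rule the_equality) (use assms uniq in blast)+
  then show "As y = z" by (simp add: adjoint_def app_def)
qed

lemma adjointD:
  assumes "y \<in> Ds" "x \<in> dom B"
  shows "cinner (app B x) y = cinner x (As y)"
proof -
  obtain z where z: "\<And>x. x \<in> dom B \<Longrightarrow> cinner (app B x) y = cinner x z"
    using assms(1) by (auto simp: adjoint_def dom_def)
  show ?thesis using z[OF assms(2)] adjointI(2)[OF z] by simp
qed

lemma dom_subset_adjoint: "x \<in> dom B \<Longrightarrow> x \<in> Ds"
  and app_adjoint: "x \<in> dom B \<Longrightarrow> As x = app B x"
  using adjointI[of x "app B x"] sym_B by blast+

lemma Ds_lincomb:
  assumes "x \<in> Ds" "y \<in> Ds"
  shows "a *\<^sub>C x + b *\<^sub>C y \<in> Ds" and "As (a *\<^sub>C x + b *\<^sub>C y) = a *\<^sub>C As x + b *\<^sub>C As y"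
proof -
  have "cinner (app B u) (a *\<^sub>C x + b *\<^sub>C y) = cinner u (a *\<^sub>C As x + b *\<^sub>C As y)" if "u \<in> dom B" for u
    using assms that by (simp add: cinner_simps adjointD)
  from adjointI[OF this] show "a *\<^sub>C x + b *\<^sub>C y \<in> Ds"
    "As (a *\<^sub>C x + b *\<^sub>C y) = a *\<^sub>C As x + b *\<^sub>C As y" by blast+
qed

lemma As_add: "x \<in> Ds \<Longrightarrow> y \<in> Ds \<Longrightarrow> As (x + y) = As x + As y"
  and Ds_add: "x \<in> Ds \<Longrightarrow> y \<in> Ds \<Longrightarrow> x + y \<in> Ds"
  using Ds_lincomb[of x y 1 1] by (simp_all add: scaleC_one)

lemma As_diff: "x \<in> Ds \<Longrightarrow> y \<in> Ds \<Longrightarrow> As (x - y) = As x - As y"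
  and Ds_diff: "x \<in> Ds \<Longrightarrow> y \<in> Ds \<Longrightarrow> x - y \<in> Ds"
  using Ds_lincomb[of x y 1 "- 1"] by (simp_all add: scaleC_one scaleC_minus_left)

lemma As_scale: "x \<in> Ds \<Longrightarrow> As (c *\<^sub>C x) = c *\<^sub>C As x"
  and Ds_scale: "x \<in> Ds \<Longrightarrow> c *\<^sub>C x \<in> Ds"
  using Ds_lincomb[of x x c 0] by simp_all

lemma zero_Ds: "0 \<in> Ds"
  using sub_B dom_subset_adjoint by (simp add: csubspace_def)

lemma G_lincomb:
  assumes "x \<in> Ds" "y \<in> Ds"
  shows "G1 (a *\<^sub>C x + b *\<^sub>C y) = a *s G1 x + b *s G1 y"
    and "G2 (a *\<^sub>C x + b *\<^sub>C y) = a *s G2 x + b *s G2 y"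
  using triplet assms unfolding boundary_triplet_def Let_def by blast+

lemma green:
  "x \<in> Ds \<Longrightarrow> y \<in> Ds \<Longrightarrow> cinner (As x) y - cinner x (As y) = vinner (G2 x) (G1 y) - vinner (G1 x) (G2 y)"
  using triplet unfolding boundary_triplet_def Let_def by blast

lemma G_surj: obtains x where "x \<in> Ds" "G1 x = u" "G2 x = v"
  using triplet unfolding boundary_triplet_def Let_def by blast

lemma G1_zero: "G1 0 = 0" and G2_zero: "G2 0 = 0"
  using G_lincomb[OF zero_Ds zero_Ds, of 0 0] by simp_all

lemma G1_add: "x \<in> Ds \<Longrightarrow> y \<in> Ds \<Longrightarrow> G1 (x + y) = G1 x + G1 y"
  and G2_add: "x \<in> Ds \<Longrightarrow> y \<in> Ds \<Longrightarrow> G2 (x + y) = G2 x + G2 y"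
  using G_lincomb[of x y 1 1] by (simp_all add: scaleC_one)

lemma G1_scale: "x \<in> Ds \<Longrightarrow> G1 (c *\<^sub>C x) = c *s G1 x"
  and G2_scale: "x \<in> Ds \<Longrightarrow> G2 (c *\<^sub>C x) = c *s G2 x"
  using G_lincomb[of x x c 0] by simp_all

text \<open>Green's formula puts \<open>y\<close> into the domain of the double adjoint, which is
  \<open>B\<close> again as \<open>B\<close> is closed. Concretely, \<open>b\<close> in the domain
  of \<open>B\<close> is chosen so that \<open>(B* + i) (y - b)\<close> is orthogonal to the range
  of \<open>B + i\<close>, and \<open>y = b\<close> is deduced.\<close>

lemma G_zero_imp_dom:
  assumes y: "y \<in> Ds" and G: "G1 y = 0" "G2 y = 0"
  shows "y \<in> dom B"
proof -
  have sym: "cinner (As x) y = cinner x (As y)" if "x \<in> Ds" for x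
    using green[OF that y] G by simp
  obtain b where b: "b \<in> dom B" and orth: "\<And>u. u \<in> dom B \<Longrightarrow>
      cinner (app B u + \<i> *\<^sub>C u) ((As y + \<i> *\<^sub>C y) - (app B b + \<i> *\<^sub>C b)) = 0"
    using symmetric_closed_range[OF symmetric closed] by blast
  define d where "d = y - b"
  define w where "w = As d + \<i> *\<^sub>C d"
  have bs: "b \<in> Ds" "As b = app B b" using b by (auto simp: dom_subset_adjoint app_adjoint)
  have d: "d \<in> Ds" unfolding d_def by (rule Ds_diff[OF y bs(1)])
  have w: "w = (As y + \<i> *\<^sub>C y) - (app B b + \<i> *\<^sub>C b)"
    by (simp add: w_def d_def As_diff[OF y bs(1)] bs(2) scaleC_diff_right)
  have sym_d: "cinner (As x) d = cinner x (As d)" if "x \<in> Ds" for x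
  proof -
    have "cinner (As x) b = cinner x (app B b)"
      using adjointD[OF that b] cinner_cnj[of "As x" b] cinner_cnj[of x "app B b"] by simp
    then show ?thesis using sym[OF that] by (simp add: d_def cinner_diff_right As_diff[OF y bs(1)] bs(2))
  qed
  \<comment> \<open>Orthogonality to the range of \<open>B + i\<close> means that \<open>w\<close>
    is in the kernel of \<open>B* - i\<close>; pairing \<open>w\<close> with \<open>d\<close> gives
    \<open>w = 0\<close>. Then \<open>d\<close> is in the kernel of \<open>B* + i\<close>, and
    pairing it with itself gives \<open>d = 0\<close>.\<close>
  have "cinner (app B u) w = cinner u (\<i> *\<^sub>C w)" if "u \<in> dom B" for u
    using orth[OF that] unfolding w[symmetric] by (simp add: cinner_simps add_eq_0_iff)
  from adjointI[OF this] have ws: "w \<in> Ds" "As w = \<i> *\<^sub>C w" by blast+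
  have "cinner w w = cinner w (As d) + cinner w (\<i> *\<^sub>C d)" by (simp add: w_def cinner_add_right)
  also have "\<dots> = 0" using sym_d[OF ws(1)] by (simp add: ws(2) cinner_simps)
  finally have "w = 0" by (simp add: cinner_eq_zero_iff)
  then have "As d = - (\<i> *\<^sub>C d)" by (simp add: w_def eq_neg_iff_add_eq_0)
  then have "cinner d d = 0" using sym_d[OF d] by (simp add: cinner_simps)
  then have "d = 0" by (simp add: cinner_eq_zero_iff)
  then show ?thesis using b by (simp add: d_def)
qed

text \<open>For \<open>y\<close> in the domain of \<open>B\<close> the left side of Green's formula
  vanishes against every \<open>x\<close>; joint surjectivity of the boundary maps allows each
  component to be tested separately.\<close>

lemma G_dom:
  assumes y: "y \<in> dom B"
  shows "G1 y = 0" and "G2 y = 0"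
proof -
  have eq: "vinner (G2 x) (G1 y) = vinner (G1 x) (G2 y)" if "x \<in> Ds" for x
    using green[OF that dom_subset_adjoint[OF y]] adjointD[OF that y]
      cinner_cnj[of "As x" y] cinner_cnj[of x "app B y"] by (simp add: app_adjoint[OF y])
  show "G1 y = 0"
  proof (rule vinner_nondegenerate_right)
    fix u obtain x where "x \<in> Ds" "G1 x = 0" "G2 x = u" using G_surj by blast
    then show "vinner u (G1 y) = 0" using eq[of x] by simp
  qed
  show "G2 y = 0"
  proof (rule vinner_nondegenerate_right)
    fix u obtain x where "x \<in> Ds" "G1 x = u" "G2 x = 0" using G_surj by blast
    then show "vinner u (G2 y) = 0" using eq[of x] by simp
  qed
qed

text \<open>Self-adjointness of \<open>A\<^sub>1\<close>. For maximality, \<open>g\<close> is in the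
  domain of \<open>B*\<close> since \<open>A\<^sub>1\<close> extends \<open>B\<close>, and Green's
  formula with \<open>G1 y = 0\<close> and \<open>G2 y\<close> arbitrary forces
  \<open>G1 g = 0\<close>.\<close>

sublocale sa_operator D1 As
proof
  show "csubspace D1"
    by (auto simp: csubspace_def D1_def zero_Ds G1_zero Ds_add G1_add Ds_scale G1_scale)
next
  fix g h assume gh: "\<And>y. y \<in> D1 \<Longrightarrow> cinner (As y) g = cinner y h"
  have "cinner (app B y) g = cinner y h" if "y \<in> dom B" for y
    using gh[of y] that by (simp add: D1_def dom_subset_adjoint G_dom app_adjoint)
  from adjointI[OF this] have g: "g \<in> Ds" "As g = h" by blast+
  have "G1 g = 0"
  proof (rule vinner_nondegenerate_right)
    fix u obtain y where y: "y \<in> Ds" "G1 y = 0" "G2 y = u" using G_surj by blast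
    then show "vinner u (G1 g) = 0" using green[OF y(1) g(1)] gh[of y] g(2) by (simp add: D1_def)
  qed
  then show "g \<in> D1 \<and> As g = h" using g by (simp add: D1_def)
next
  fix x y assume "x \<in> D1" "y \<in> D1"
  then show "cinner (As x) y = cinner x (As y)" using green[of x y] by (simp add: D1_def)
qed (auto simp: D1_def As_add As_scale)

lemma dom_iff: "y \<in> dom B \<longleftrightarrow> y \<in> D1 \<and> G2 y = 0"
  using G_zero_imp_dom G_dom dom_subset_adjoint by (auto simp: D1_def)

lemma D1_imp_Ds: "y \<in> D1 \<Longrightarrow> y \<in> Ds"
  by (simp add: D1_def)

section \<open>Consequences of complete non-selfadjointness\<close>

text \<open>Vanishing of \<open>G2\<close> on the part of \<open>D1\<close> in \<open>L\<close>
  makes that part a subset of the domain of \<open>B\<close>. So \<open>L\<close> reduces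
  \<open>B\<close> as well, and the parts of \<open>A\<^sub>1\<close> and \<open>B\<close> in
  \<open>L\<close> coincide.\<close>

lemma no_reducing_subspace:
  assumes L: "csubspace L" "cclosed L"
    and red: "\<And>y. y \<in> D1 \<Longrightarrow> proj L y \<in> D1 \<and> As (proj L y) = proj L (As y)"
    and G2: "\<And>y. y \<in> D1 \<Longrightarrow> y \<in> L \<Longrightarrow> G2 y = 0"
  shows "L = {0}"
proof -
  have in_dom: "proj L y \<in> dom B" if "y \<in> D1" for y
    using red[OF that] G2 proj_in[OF L] by (simp add: dom_iff)
  have "reduces L B"
    unfolding reduces_def
  proof (intro conjI L ballI)
    fix x assume x: "x \<in> dom B"
    then have "x \<in> D1" by (simp add: dom_iff)
    then show "proj L x \<in> dom B" "app B (proj L x) = proj L (app B x)"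
      using in_dom[of x] red[of x] x by (simp_all add: app_adjoint[symmetric])
  qed
  moreover have "part_selfadjoint L B"
    unfolding part_selfadjoint_def
  proof (intro conjI ballI)
    show "dense_in (dom B \<inter> L) L"
      unfolding dense_in_def
    proof (intro conjI ballI allI impI)
      fix x and e :: real assume x: "x \<in> L" and "e > 0"
      then obtain y where y: "y \<in> dom B" "cnorm (x - y) < e"
        using dense_B unfolding dense_in_def by blast
      have "cnorm (x - proj L y) \<le> cnorm (x - y)"
        using cnorm_proj_le[OF L, of "x - y"] by (simp add: proj_diff[OF L] proj_self[OF L x])
      moreover have "proj L y \<in> dom B \<inter> L" using in_dom y(1) proj_in[OF L] by (simp add: dom_iff)
      ultimately show "\<exists>y\<in>dom B \<inter> L. cnorm (x - y) < e" using y(2)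
        by (meson le_less_trans)
    qed simp
    have app_L: "app B x \<in> L" if "x \<in> dom B \<inter> L" for x
    proof -
      have "app B x = proj L (app B x)"
        using red[of x] that by (simp add: proj_self[OF L] dom_iff flip: app_adjoint)
      then show ?thesis using proj_in[OF L, of "app B x"] by simp
    qed
    then show "app B x \<in> L" if "x \<in> dom B \<inter> L" for x using that .
    show "cinner (app B x) y = cinner x (app B y)" if "x \<in> dom B \<inter> L" "y \<in> dom B \<inter> L" for x y
      using that sym_B by blast
    show "(\<exists>z\<in>L. \<forall>x\<in>dom B \<inter> L. cinner (app B x) y = cinner x z) \<longleftrightarrow> y \<in> dom B" if y: "y \<in> L" for y
    proof
      assume "\<exists>z\<in>L. \<forall>x\<in>dom B \<inter> L. cinner (app B x) y = cinner x z"
      then obtain z where z: "z \<in> L" "\<And>x. x \<in> dom B \<Longrightarrow> x \<in> L \<Longrightarrow> cinner (app B x) y = cinner x z"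
        by blast
      \<comment> \<open>The condition tested on \<open>L\<close> extends to all of \<open>D1\<close>
        through the projection, so maximality of \<open>A\<^sub>1\<close> applies.\<close>
      have "cinner (As x) y = cinner x z" if x: "x \<in> D1" for x
      proof -
        have "cinner (As x) y = cinner (As (proj L x)) y"
          using red[OF x] cinner_proj_left[OF L y] by simp
        also have "\<dots> = cinner (proj L x) z"
          using z(2)[OF in_dom[OF x] proj_in[OF L]] by (simp add: app_adjoint[OF in_dom[OF x]])
        also have "\<dots> = cinner x z" by (rule cinner_proj_left[OF L z(1)])
        finally show ?thesis .
      qed
      from maximal[OF this] have "y \<in> D1" by blast
      then show "y \<in> dom B" using G2 y by (simp add: dom_iff)
    next
      assume "y \<in> dom B"
      then show "\<exists>z\<in>L. \<forall>x\<in>dom B \<inter> L. cinner (app B x) y = cinner x z"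
        using y app_L[of y] sym_B[of _ y] by (intro bexI[of _ "app B y"]) auto
    qed
  qed
  ultimately show ?thesis using cns unfolding completely_non_selfadjoint_def by blast
qed

text \<open>The eigenspace of \<open>B\<close> at a real point is closed, reduces
  \<open>A\<^sub>1\<close> by symmetry, and lies in the kernel of \<open>G2\<close>.\<close>

lemma no_real_eigenvector:
  assumes y: "y \<in> dom B" "app B y = complex_of_real x *\<^sub>C y"
  shows "y = 0"
proof -
  let ?x = "complex_of_real x"
  define L where "L = {y \<in> dom B. app B y = ?x *\<^sub>C y}"
  have "csubspace L"
    using sub_B linear_op_scale[OF lin_B, of 0 0]
    by (auto simp: L_def csubspace_def linear_op_add[OF lin_B] linear_op_scale[OF lin_B]
        scaleC_add_right scaleC_scaleC mult.commute)
  moreover have "cclosed L"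
    unfolding cclosed_def
  proof (intro allI impI, elim conjE)
    fix X l assume X: "\<forall>k. X k \<in> L" "converges_to X l"
    have "(\<lambda>k. \<bar>x\<bar> * cnorm (X k - l)) \<longlonglongrightarrow> 0"
      using X(2) tendsto_mult_right_zero unfolding converges_to_def by blast
    then have "converges_to (\<lambda>k. app B (X k)) (?x *\<^sub>C l)"
      using X(1) by (simp add: converges_to_def L_def cnorm_scaleC flip: scaleC_diff_right)
    then show "l \<in> L" using closed X unfolding closed_op_def L_def by blast
  qed
  moreover have "L = {0}" if L: "csubspace L" "cclosed L"
  proof (rule no_reducing_subspace[OF L])
    fix v assume v: "v \<in> D1"
    have p: "proj L v \<in> L" by (rule proj_in[OF L])
    then have pD: "proj L v \<in> dom B" and pe: "As (proj L v) = ?x *\<^sub>C proj L v"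
      by (auto simp: L_def app_adjoint)
    have "proj L (As v) = ?x *\<^sub>C proj L v"
    proof (rule proj_unique[OF L])
      show "?x *\<^sub>C proj L v \<in> L" using p L(1) by (simp add: csubspace_def)
      fix z assume z: "z \<in> L"
      have "cinner (As v) z = cinner v (?x *\<^sub>C z)"
        using sym[OF v, of z] z by (auto simp: L_def app_adjoint dom_iff)
      then show "cinner (As v - ?x *\<^sub>C proj L v) z = 0"
        using cinner_proj_left[OF L z, of v] by (simp add: cinner_simps)
    qed
    then show "proj L v \<in> D1 \<and> As (proj L v) = proj L (As v)" using pD pe by (simp add: dom_iff)
  next
    fix v assume "v \<in> D1" "v \<in> L"
    then show "G2 v = 0" by (simp add: L_def dom_iff)
  qed
  moreover have "y \<in> L" using y by (simp add: L_def)
  ultimately show ?thesis by blast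
qed

section \<open>The sets \<open>F\<^sub>k\<close>\<close>

text \<open>The set \<open>F\<^sub>k\<close>, with the maximum norm on the boundary values and with
  complex points allowed. Working with coordinates suits the Riesz theorem, which represents scalar
  functionals.\<close>

definition bound_set :: "nat \<Rightarrow> complex set" where
  "bound_set k = {z. \<forall>y\<in>D1. \<forall>i. cmod (G2 y $ i) \<le> real k * cnorm (shift z y)}"

lemma closed_bound_set: "closed (bound_set k)"
proof -
  have "bound_set k = (\<Inter>y\<in>D1. \<Inter>i. {z. cmod (G2 y $ i) \<le> real k * cnorm (shift z y)})"
    by (auto simp: bound_set_def)
  moreover have "closed {z. cmod (G2 y $ i) \<le> real k * cnorm (shift z y)}" for y i
    by (intro closed_Collect_le continuous_intros continuous_on_cnorm_shift)
  ultimately show ?thesis by (simp add: closed_INT)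
qed

text \<open>An eigenvector of \<open>A\<^sub>1\<close> obeying the bound has
  \<open>G2 y = 0\<close>, so it is an eigenvector of \<open>B\<close> at a real point.\<close>

lemma bounded_imp_inj:
  assumes bound: "\<And>i. cmod (G2 y $ i) \<le> C * cnorm (shift (complex_of_real x) y)"
    and y: "y \<in> D1" "shift (complex_of_real x) y = 0"
  shows "y = 0"
proof -
  have "G2 y = 0" using bound y(2) by (simp add: vec_eq_iff)
  then have "y \<in> dom B" using y(1) by (simp add: dom_iff)
  then show ?thesis using no_real_eigenvector[of y x] y(2) by (simp add: shift_def app_adjoint)
qed

text \<open>A relatively open piece of the spectrum inside \<open>bound_set k\<close> would produce
  a nonzero reducing subspace on which \<open>G2\<close> vanishes.\<close>

lemma spectrum_minus_bound_set_dense: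
  "spectrum_op (D1, As) \<subseteq> closure (spectrum_op (D1, As) - bound_set k)"
proof
  fix x assume x: "x \<in> spectrum_op (D1, As)"
  define x0 where "x0 = Re x"
  have spec: "complex_of_real x0 \<in> spectrum_op (D1, As)" and xx: "x = complex_of_real x0"
    using x spectrum_real[OF x] by (simp_all add: x0_def)
  show "x \<in> closure (spectrum_op (D1, As) - bound_set k)"
  proof (rule ccontr)
    assume "x \<notin> closure (spectrum_op (D1, As) - bound_set k)"
    then obtain e where e: "e > 0" "\<And>s. dist s x < e \<Longrightarrow> s \<in> spectrum_op (D1, As) \<Longrightarrow> s \<in> bound_set k"
      unfolding closure_approachable by blast
    have bound: "cmod (G2 y $ i) \<le> 2 * real k * cnorm (shift z y)"
      if "z \<in> ball (complex_of_real x0) (e / 2)" "y \<in> D1" for z y i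
    proof (rule spectrum_bound_spreads[OF spec _ _ that])
      fix s y assume s: "s \<in> spectrum_op (D1, As)" "s \<in> ball (complex_of_real x0) e" "y \<in> D1"
      then have "s \<in> bound_set k" using e(2)[of s] by (simp add: xx dist_commute)
      then show "cmod (G2 y $ i) \<le> real k * cnorm (shift s y)" using s(3) by (simp add: bound_set_def)
    qed simp
    \<comment> \<open>At real points this comes from complete non-selfadjointness through the bound,
      at nonreal points from symmetry alone.\<close>
    have inj: "y = 0"
      if "z \<in> ball (complex_of_real x0) (e / 2)" "y \<in> D1" "shift z y = 0" for z y
    proof (cases "Im z = 0")
      case True
      then have "z = complex_of_real (Re z)" by (simp add: complex_eq_iff)
      then show ?thesis using bounded_imp_inj[of y "2 * real k" "Re z"] bound[OF that(1,2)] that(2,3) by simp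
    next
      case False
      then show ?thesis using bounded_below_inj[OF bounded_below_nonreal] that by blast
    qed
    obtain L where L: "csubspace L" "cclosed L" "L \<noteq> {0}"
      and red: "\<And>y. y \<in> D1 \<Longrightarrow> proj L y \<in> D1 \<and> As (proj L y) = proj L (As y)"
      and zero: "\<And>l y. l \<in> range (\<lambda>i y. G2 y $ i) \<Longrightarrow> y \<in> D1 \<Longrightarrow> y \<in> L \<Longrightarrow> l y = 0"
    \<comment> \<open>The functionals are the coordinates of \<open>G2\<close>. The required bound
      involves \<open>cnj z\<close>, which gives the same norm as \<open>z\<close>.\<close>
    proof (rule exists_reducing_subspace[of "e / 2" "range (\<lambda>i y. G2 y $ i)" x0])
      show "e / 2 > 0" using e(1) by simp
      fix l assume "l \<in> range (\<lambda>i y. G2 y $ i)"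
      then obtain i where l: "l = (\<lambda>y. G2 y $ i)" by blast
      show "l (x + y) = l x + l y" if "x \<in> D1" "y \<in> D1" for x y
        using that by (simp add: l G2_add D1_imp_Ds)
      show "l (c *\<^sub>C x) = c * l x" if "x \<in> D1" for c x
        using that by (simp add: l G2_scale D1_imp_Ds)
      show "\<exists>M\<ge>0. \<forall>z\<in>ball (complex_of_real x0) (e / 2). \<forall>y\<in>D1. cmod (l y) \<le> M * cnorm (shift (cnj z) y)"
        using bound by (intro exI[of _ "2 * real k"]) (auto simp: l cnorm_shift_cnj)
    next
      fix L
      assume "csubspace L" "cclosed L" "L \<noteq> {0}"
        "\<And>y. y \<in> D1 \<Longrightarrow> proj L y \<in> D1 \<and> As (proj L y) = proj L (As y)"
        "\<And>l y. l \<in> range (\<lambda>i y. G2 y $ i) \<Longrightarrow> y \<in> D1 \<Longrightarrow> y \<in> L \<Longrightarrow> l y = 0"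
      then show thesis by (rule that)
    qed (use inj spec in blast)+
    have "G2 y = 0" if "y \<in> D1" "y \<in> L" for y
      using zero[OF _ that] by (auto simp: vec_eq_iff)
    then show False using no_reducing_subspace[OF L(1,2) red] L(3) by blast
  qed
qed

section \<open>Eigenvalues of maximum multiplicity\<close>

abbreviation ext :: "complex ^ 'n ^ 'n \<Rightarrow> 'a op" where
  "ext D \<equiv> restrict_op (adjoint B) {x. G2 x = D *v G1 x}"

lemma mem_ker_ext: "f \<in> ker_shift (ext D) z \<longleftrightarrow> f \<in> Ds \<and> G2 f = D *v G1 f \<and> As f = z *\<^sub>C f"
  by (auto simp: ker_shift_def restrict_op_def dom_def app_def)

lemma csubspace_ker_ext: "csubspace (ker_shift (ext D) z)"
  unfolding csubspace_def
  by (auto simp: mem_ker_ext zero_Ds Ds_add Ds_scale G1_zero G2_zero G1_add G2_add G1_scale G2_scale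
      As_add As_scale matrix_vector_right_distrib vec.scale scaleC_add_right scaleC_scaleC mult.commute
      As_scale[OF zero_Ds, of 0, simplified])

lemma ker_ext_lincomb:
  "x \<in> ker_shift (ext D) z \<Longrightarrow> y \<in> ker_shift (ext D) z \<Longrightarrow>
    G1 (a *\<^sub>C x + b *\<^sub>C y) = a *s G1 x + b *s G1 y"
  by (simp add: mem_ker_ext G_lincomb)

text \<open>On the eigenspace \<open>G1\<close> is injective, since \<open>G1 f = 0\<close> forces
  \<open>G2 f = 0\<close>, and by dimension it is onto. Eigenvectors \<open>g i\<close> with
  \<open>G1 (g i)\<close> the standard basis then represent the coordinates of \<open>G2\<close>
  through \<open>A\<^sub>1 - x\<close>, by Green's formula.\<close>

lemma max_eigenvalue_imp_bound:
  fixes D :: "complex ^ 'n ^ 'n"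
  assumes "complex_of_real x \<in> sigma_p_max CARD('n) (ext D)"
  shows "\<exists>k. complex_of_real x \<in> bound_set k"
proof -
  let ?x = "complex_of_real x"
  let ?V = "ker_shift (ext D) ?x"
  have inj: "f = 0" if f: "f \<in> ?V" "G1 f = 0" for f
  proof -
    have "f \<in> dom B" using f by (intro G_zero_imp_dom) (auto simp: mem_ker_ext)
    then show ?thesis using f(1) no_real_eigenvector[of f x] by (simp add: mem_ker_ext app_adjoint)
  qed
  have "\<exists>g\<in>?V. G1 g = axis i 1" for i
    using assms by (intro cdim_eq_inj_imp_surj[OF csubspace_ker_ext _ ker_ext_lincomb inj])
      (auto simp: sigma_p_max_def)
  then obtain g where g: "\<And>i. g i \<in> ?V" "\<And>i. G1 (g i) = axis i 1" by metis
  \<comment> \<open>The sum dominates every single norm, so one \<open>k\<close> serves all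
    coordinates.\<close>
  obtain k :: nat where k: "(\<Sum>i\<in>UNIV. cnorm (g i)) \<le> real k" using real_arch_simple by blast
  have "cmod (G2 y $ i) \<le> real k * cnorm (shift ?x y)" if y: "y \<in> D1" for y i
  proof -
    have gi: "g i \<in> Ds" "As (g i) = ?x *\<^sub>C g i" using g(1)[of i] by (auto simp: mem_ker_ext)
    have "G2 y $ i = cinner (shift ?x y) (g i)"
      using green[OF D1_imp_Ds[OF y] gi(1)] y by (simp add: g(2) gi(2) D1_def shift_def cinner_simps)
    then have "cmod (G2 y $ i) \<le> cnorm (shift ?x y) * cnorm (g i)" by (simp add: cauchy_schwarz)
    also have "\<dots> \<le> cnorm (shift ?x y) * real k"
      using k member_le_sum[of i UNIV "\<lambda>i. cnorm (g i)"] by (intro mult_left_mono) auto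
    finally show ?thesis by (simp add: mult.commute)
  qed
  then show ?thesis unfolding bound_set_def by blast
qed

text \<open>The converse construction: the Riesz vectors \<open>g i\<close> of the coordinates of
  \<open>G2\<close> lie in the kernel of \<open>B* - x\<close>, and Green's formula shows that
  \<open>G1\<close> maps them to the standard basis.\<close>

lemma bound_imp_max_eigenvalue:
  assumes x: "complex_of_real x \<in> bound_set k"
  shows "\<exists>D. hermitian D \<and> complex_of_real x \<in> sigma_p_max CARD('n) (ext D)"
proof -
  let ?x = "complex_of_real x"
  have bound: "cmod (G2 y $ i) \<le> real k * cnorm (shift ?x y)" if "y \<in> D1" for y i
    using x that by (simp add: bound_set_def)
  have "\<exists>g. \<forall>y\<in>D1. cinner (shift ?x y) g = G2 y $ i" for i
  proof -
    obtain g Y where "\<And>y. y \<in> D1 \<Longrightarrow> cinner (shift ?x y) g = G2 y $ i"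
      and "\<And>n::nat. Y n \<in> D1" "converges_to (\<lambda>n. shift ?x (Y n)) g"
    proof (rule riesz_range[OF subspace, of "shift ?x" "\<lambda>y. G2 y $ i" "real k"])
      fix g Y
      assume "\<And>y. y \<in> D1 \<Longrightarrow> cinner (shift ?x y) g = G2 y $ i" "\<And>n::nat. Y n \<in> D1"
        "converges_to (\<lambda>n. shift ?x (Y n)) g"
      then show thesis by (rule that)
    qed (simp_all add: bound shift_add shift_scale G2_add G2_scale D1_imp_Ds)
    then show ?thesis by blast
  qed
  then obtain g where g: "\<And>y i. y \<in> D1 \<Longrightarrow> cinner (shift ?x y) (g i) = G2 y $ i" by metis
  have gN: "g i \<in> Ds" "As (g i) = ?x *\<^sub>C g i" for i
  proof -
    have "cinner (app B y) (g i) = cinner y (?x *\<^sub>C g i)" if y: "y \<in> dom B" for y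
    proof -
      have "y \<in> D1" "G2 y = 0" using y by (simp_all add: dom_iff)
      then show ?thesis using g[of y i] by (simp add: shift_def cinner_simps app_adjoint[OF y])
    qed
    from adjointI[OF this] show "g i \<in> Ds" "As (g i) = ?x *\<^sub>C g i" by blast+
  qed
  have gG1: "G1 (g i) = axis i 1" for i
  proof -
    have "vinner u (G1 (g i) - axis i 1) = 0" for u
    proof -
      obtain y where y: "y \<in> Ds" "G1 y = 0" "G2 y = u" using G_surj by blast
      then have "y \<in> D1" by (simp add: D1_def)
      have "vinner u (G1 (g i)) = cinner (shift ?x y) (g i)"
        using green[OF y(1) gN(1)[of i]] by (simp add: y gN(2) shift_def cinner_simps)
      also have "\<dots> = u $ i" using g[OF \<open>y \<in> D1\<close>] y(3) by simp
      finally show ?thesis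
        using vinner_axis_right[of u i] by (simp add: vinner_def right_diff_distrib sum_subtractf)
    qed
    from vinner_nondegenerate_right[OF this] show ?thesis by simp
  qed
  \<comment> \<open>The columns are the vectors \<open>G2 (g i)\<close>, so that
    \<open>G2 = D G1\<close> on the span of the \<open>g i\<close>.\<close>
  define D :: "complex ^ 'n ^ 'n" where "D = (\<chi> j i. G2 (g i) $ j)"
  have "hermitian D"
    unfolding hermitian_def
  proof (intro allI)
    fix i j
    \<comment> \<open>Both vectors belong to the kernel of \<open>B* - x\<close> with
      \<open>x\<close> real, so the left side of Green's formula is zero.\<close>
    have "vinner (G2 (g j)) (axis i 1) - vinner (axis j 1) (G2 (g i)) = 0"
      using green[OF gN(1)[of j] gN(1)[of i]] by (simp add: gG1 gN(2) cinner_simps)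
    then show "D $ i $ j = cnj (D $ j $ i)" by (simp add: D_def)
  qed
  moreover have "cdim_eq (ker_shift (ext D) ?x) CARD('n)"
  proof (rule cdim_eq_dual_basis[OF csubspace_ker_ext ker_ext_lincomb _ _ gG1])
    have "D *v axis i 1 = G2 (g i)" for i
      by (simp add: matrix_vector_mult_def axis_def D_def vec_eq_iff if_distrib[of "(*) _"] cong: if_cong)
    then show "g i \<in> ker_shift (ext D) ?x" for i by (simp add: mem_ker_ext gN gG1)
  next
    fix f assume f: "f \<in> ker_shift (ext D) ?x" "G1 f = 0"
    then have "f \<in> D1" "shift ?x f = 0" by (auto simp: mem_ker_ext D1_def shift_def)
    then show "f = 0" using bounded_imp_inj[of f "real k" x] bound by blast
  qed
  ultimately show ?thesis unfolding sigma_p_max_def by blast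
qed

end

section \<open>Baire category in the spectrum\<close>

theorem theorem1p1:
  fixes B :: "'a::complex_hilbert op"
    and G1 G2 :: "'a \<Rightarrow> complex ^ 'n::finite"
  assumes "symmetric_op B" and "closed_op B"
    and "completely_non_selfadjoint B"
    and "deficiency_indices_eq B CARD('n)"
    and "boundary_triplet B G1 G2"
  shows "let A1 = restrict_op (adjoint B) {x. G1 x = 0};
             AD = (\<lambda>D. restrict_op (adjoint B) {x. G2 x = D *v G1 x});
             S = {x \<in> spectrum_op A1. \<forall>D. hermitian D \<longrightarrow> x \<notin> sigma_p_max CARD('n) (AD D)}
         in gdelta_in (top_of_set (spectrum_op A1)) S \<and>
            (top_of_set (spectrum_op A1)) closure_of S = spectrum_op A1"
proof -
  interpret boundary_problem B G1 G2
    using assms by unfold_locales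
  define \<sigma> where "\<sigma> = spectrum_op (D1, As)"
  define S where "S = {x \<in> \<sigma>. \<forall>D. hermitian D \<longrightarrow> x \<notin> sigma_p_max CARD('n) (ext D)}"
  have "restrict_op (adjoint B) {x. G1 x = 0} = (D1, As)" by (simp add: restrict_op_def D1_def)
  then have A1: "spectrum_op (restrict_op (adjoint B) {x. G1 x = 0}) = \<sigma>" by (simp add: \<sigma>_def)
  \<comment> \<open>Spectral points are real, so the two preceding implications identify the
    complement of \<open>S\<close> in the spectrum with the union of the sets
    \<open>bound_set k\<close>.\<close>
  have "x \<in> S \<longleftrightarrow> (\<forall>k. x \<notin> bound_set k)" if "x \<in> \<sigma>" for x
  proof -
    have x: "x = complex_of_real (Re x)" using that spectrum_real unfolding \<sigma>_def by blast
    show ?thesis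
      using max_eigenvalue_imp_bound[of "Re x"] bound_imp_max_eigenvalue[of "Re x"] that
      unfolding x[symmetric] S_def by blast
  qed
  then have S: "S = \<Inter>(range (\<lambda>k. \<sigma> - bound_set k))" by (auto simp: S_def)
  have open_k: "openin (top_of_set \<sigma>) (\<sigma> - bound_set k)" for k
    by (simp add: Diff_eq openin_open_Int closed_bound_set open_Compl)
  have "gdelta_in (top_of_set \<sigma>) S"
    unfolding S by (rule gdelta_in_Inter) (auto intro: open_imp_gdelta_in open_k)
  \<comment> \<open>The spectrum is closed in the complex plane, so Baire's theorem applies to the
    relatively open dense sets \<open>\<sigma> - bound_set k\<close>.\<close>
  moreover have "\<sigma> \<subseteq> closure S"
    unfolding S
  proof (rule Baire)
    show "closed \<sigma>" unfolding \<sigma>_def by (rule closed_spectrum)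
    fix T assume "T \<in> range (\<lambda>k. \<sigma> - bound_set k)"
    then show "openin (top_of_set \<sigma>) T \<and> \<sigma> \<subseteq> closure T"
      using open_k spectrum_minus_bound_set_dense unfolding \<sigma>_def by blast
  qed simp
  then have "(top_of_set \<sigma>) closure_of S = \<sigma>"
    by (auto simp: closure_of_subtopology S_def Int_absorb1 Collect_conj_eq)
  ultimately show ?thesis unfolding Let_def A1 S_def by blast
qed

end
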